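(* Let $\mathcal{B}$ be a complex Banach space and let $\{\mathcal{L}(z,t)\}_{t\ge 0}$, $|\mathrm{Re}(z)|<\delta$, be a family of bounded linear operators on $\mathcal{B}$ which, for each fixed $z$, forms a $C^0$-semigroup in $t$ (in the sense given in the context), and suppose that conditions (D1) and (D2) given in the context hold. Then for each fixed $\theta\in(-\delta,\delta)$ there exists $\tilde\delta>0$ such that for each $s\in(-\tilde\delta,\tilde\delta)$ and each $t\ge 1$, the operator $\mathcal{L}(\theta+is,t)$ has a simple top eigenvalue $\lambda(\theta+is)^t$ and $$\mathcal{L}(\theta+is,t)=\lambda(\theta+is)^t\,\Pi_{\theta+is}+\Lambda(\theta+is,t),$$ where $\Pi_{\theta+is}\equiv\Pi(\theta+is,t)$ (the same operator for all $t\ge 1$) is the eigenprojection of $\mathcal{L}(\theta+is,t)$ corresponding to the eigenvalue $\lambda(\theta+is)^t$, and $$\Pi_{\theta+is}\Lambda(\theta+is,t)=\Lambda(\theta+is,t)\Pi_{\theta+is}=0.$$ In addition, the family $\{\Lambda(\theta+is,t)\}_{t\ge1}$ satisfies $\Lambda(\theta+is,tN)=\Lambda(\theta+is,t)^N$ for all $t\ge1$ and $N\in\mathbb{N}$, and the spectral radius of $\Lambda(\theta+is,1)$ is less than $|\lambda(\theta+is)|$.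
   Context: Setting. There are a stochastic process $\{S_t\}_{t\ge0}$ on $\mathbb{R}$ with $\lim_{t\to\infty}\frac1t\mathbb{E}(S_t)=0$, a complex Banach space $\mathcal{B}$, a number $\delta>0$, bounded linear operators $\mathcal{L}(z,t):\mathcal{B}\to\mathcal{B}$ for $z\in\mathbb{C}$, $|\mathrm{Re}(z)|<\delta$, $t\ge0$, and vectors $v\in\mathcal{B}$, $\ell\in\mathcal{B}'$ (the dual space) such that $\mathbb{E}(e^{zS_t})=\ell(\mathcal{L}(z,t)v)$ for $t>0$. For each $z$, the family is a $C^0$-semigroup: $\mathcal{L}(z,t_1+t_2)=\mathcal{L}(z,t_1)\circ\mathcal{L}(z,t_2)$ for $t_1,t_2\ge0$, $\mathcal{L}(z,0)=\mathrm{Id}$, and $\lim_{t\to0}\mathcal{L}(z,t)=\mathrm{Id}$ in operator norm. Condition (D1): (1) The following hold for all $\eta\in[0,1]$ (with the same $\delta$): (B1) $z\mapsto\mathcal{L}(z,1+\eta)$ is continuous on the strip $|\mathrm{Re}(z)|<\delta$ and holomorphic on the disc $|z|<\delta$. (B2) For each $\theta\in(-\delta,\delta)$, $\mathcal{L}(\theta,1+\eta)$ has an isolated and simple eigenvalue $\lambda(\theta,1+\eta)>0$ and the rest of its spectrum is contained inside a disk (centred at $0$) of radius smaller than $\lambda(\theta,1+\eta)$. In addition $\lambda(0,1+\eta)=1$. (B3) For each $\theta\in(-\delta,\delta)$ and all real $s\neq0$, the spectrum of $\mathcal{L}(\theta+is,1+\eta)$ is contained in $\{z\in\mathbb{C}: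 |z|<\lambda(\theta,1+\eta)\}$. (2) For each $\theta\in(-\delta,\delta)$ there exist positive numbers $r_1,r_2,K,N_0$ such that $\|\mathcal{L}(\theta+is,t)\|\le \lambda(\theta)^t/t^{r_2}$ for all $t>N_0$ and all $K<|s|<t^{r_1}$, where $\lambda(\theta)=\lambda(\theta,1)$. Condition (D2): Whenever $z\in\mathbb{C}$ is such that for all $\eta\in[0,1]$ the operator $\mathcal{L}(z,1+\eta)$ has an isolated simple (top) eigenvalue $\lambda(z,1+\eta)$, the projection $\Pi(z,1+\eta)$ onto the top eigenspace satisfies $\Pi(z,1+\eta)=\Pi(z,1)$ for all $\eta\in[0,1]$. Notation: a simple eigenvalue is "top" if the rest of the spectrum lies in a disk centred at $0$ of radius smaller than its modulus. $\lambda(z)=\lambda(z,1)$ denotes the top eigenvalue of $\mathcal{L}(z,1)$ when it exists, and $\Pi_z=\Pi(z,1)$ the corresponding eigenprojection. For $s$ near $0$, the power $\lambda(\theta+is)^t$ is taken with the principal branch. *)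

theory Defs
  imports "HOL-Analysis.Analysis"
begin

section \<open>Complex Banach spaces\<close>

text \<open>
  HOL-Analysis only has real Banach spaces (class \<open>banach\<close>). A complex Banach space is a real one
  with a multiplication by complex scalars that extends the real one and for which the norm is
  absolutely homogeneous.
\<close>

class complex_normed_vector = real_normed_vector +
  fixes scaleC :: "complex \<Rightarrow> 'a \<Rightarrow> 'a"  (infixr "*\<^sub>C" 75)
  assumes scaleC_add_right: "c *\<^sub>C (x + y) = c *\<^sub>C x + c *\<^sub>C y"
    and scaleC_add_left: "(c + d) *\<^sub>C x = c *\<^sub>C x + d *\<^sub>C x"
    and scaleC_scaleC: "c *\<^sub>C (d *\<^sub>C x) = (c * d) *\<^sub>C x"
    and scaleC_of_real: "complex_of_real r *\<^sub>C x = r *\<^sub>R x"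
    and norm_scaleC: "norm (c *\<^sub>C x) = cmod c * norm x"

class complex_banach = complex_normed_vector + banach

lemma bounded_linear_scaleC_right:
  "bounded_linear (\<lambda>x :: 'a::complex_normed_vector. c *\<^sub>C x)"
proof (rule bounded_linear_intro[where K = "cmod c"])
  fix x y :: 'a and r :: real
  show "c *\<^sub>C (x + y) = c *\<^sub>C x + c *\<^sub>C y"
    by (rule scaleC_add_right)
  show "c *\<^sub>C (r *\<^sub>R x) = r *\<^sub>R (c *\<^sub>C x)"
    by (simp add: scaleC_scaleC mult.commute flip: scaleC_of_real)
  show "norm (c *\<^sub>C x) \<le> norm x * cmod c"
    by (simp add: norm_scaleC)
qed

text \<open>
  The type \<open>'a \<Rightarrow>\<^sub>L 'b\<close> consists of the bounded real-linear operators with the operator norm.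
  It is a complex normed space under pointwise scaling; the bounded complex-linear operators are
  the closed complex subspace cut out by \<open>complex_linear\<close> below.
\<close>

instantiation blinfun :: (real_normed_vector, complex_normed_vector) complex_normed_vector
begin

lift_definition scaleC_blinfun :: "complex \<Rightarrow> 'a \<Rightarrow>\<^sub>L 'b \<Rightarrow> 'a \<Rightarrow>\<^sub>L 'b"
  is "\<lambda>c f x. c *\<^sub>C f x"
  by (rule bounded_linear_compose[OF bounded_linear_scaleC_right])

instance
proof
  fix c d :: complex and r :: real and f g :: "'a \<Rightarrow>\<^sub>L 'b"
  show "c *\<^sub>C (f + g) = c *\<^sub>C f + c *\<^sub>C g"
    by transfer (simp add: scaleC_add_right)
  show "(c + d) *\<^sub>C f = c *\<^sub>C f + d *\<^sub>C f"
    by transfer (simp add: scaleC_add_left)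
  show "c *\<^sub>C (d *\<^sub>C f) = (c * d) *\<^sub>C f"
    by transfer (simp add: scaleC_scaleC)
  show "complex_of_real r *\<^sub>C f = r *\<^sub>R f"
    by transfer (simp add: scaleC_of_real)
  have le: "norm (a *\<^sub>C h) \<le> cmod a * norm h" for a and h :: "'a \<Rightarrow>\<^sub>L 'b"
  proof (rule norm_blinfun_bound)
    fix x
    have "norm (blinfun_apply (a *\<^sub>C h) x) = cmod a * norm (blinfun_apply h x)"
      by (simp add: scaleC_blinfun.rep_eq norm_scaleC)
    also have "\<dots> \<le> cmod a * (norm h * norm x)"
      by (intro mult_left_mono norm_blinfun) simp
    finally show "norm (blinfun_apply (a *\<^sub>C h) x) \<le> cmod a * norm h * norm x"
      by (simp add: mult.assoc)
  qed simp
  show "norm (c *\<^sub>C f) = cmod c * norm f"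
  proof (cases "c = 0")
    case True
    then show ?thesis
      using le[of c f] by simp
  next
    case False
    have "inverse c *\<^sub>C (c *\<^sub>C f) = f"
      using False by transfer (simp add: scaleC_scaleC scaleC_of_real[of 1, simplified])
    then have "norm f \<le> inverse (cmod c) * norm (c *\<^sub>C f)"
      using le[of "inverse c" "c *\<^sub>C f"] by (simp add: norm_inverse)
    then have "cmod c * norm f \<le> norm (c *\<^sub>C f)"
      using False by (simp add: field_simps)
    with le[of c f] show ?thesis
      by simp
  qed
qed

end

instance blinfun :: (real_normed_vector, complex_banach) complex_banach ..

definition complex_linear :: "('a::complex_normed_vector \<Rightarrow>\<^sub>L 'b::complex_normed_vector) \<Rightarrow> bool" where
  "complex_linear T \<longleftrightarrow> (\<forall>c x. blinfun_apply T (c *\<^sub>C x) = c *\<^sub>C blinfun_apply T x)"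

text \<open>
  Holomorphy for functions with values in a complex normed space: this is \<open>holomorphic_on\<close> with
  the multiplication of the field replaced by scalar multiplication.
\<close>

definition vholomorphic_on :: "(complex \<Rightarrow> 'b::complex_normed_vector) \<Rightarrow> complex set \<Rightarrow> bool"
  (infixl "vholomorphic'_on" 50) where
  "f vholomorphic_on S \<longleftrightarrow>
     (\<forall>z\<in>S. \<exists>D. (f has_derivative (\<lambda>h. h *\<^sub>C D)) (at z within S))"


section \<open>Spectral theory of bounded operators\<close>

text \<open>
  An inverse of a complex-linear operator is complex-linear, so for complex-linear \<open>T\<close> it is
  harmless that the inverse below ranges over the real-linear operators.
\<close>

definition is_blinfun_inverse ::
  "('a::real_normed_vector \<Rightarrow>\<^sub>L 'a) \<Rightarrow> ('a \<Rightarrow>\<^sub>L 'a) \<Rightarrow> bool" where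
  "is_blinfun_inverse T S \<longleftrightarrow> S o\<^sub>L T = id_blinfun \<and> T o\<^sub>L S = id_blinfun"

definition spectrum :: "('a::complex_banach \<Rightarrow>\<^sub>L 'a) \<Rightarrow> complex set" where
  "spectrum T = {\<zeta>. \<nexists>S. is_blinfun_inverse (\<zeta> *\<^sub>C id_blinfun - T) S}"

definition resolvent :: "('a::complex_banach \<Rightarrow>\<^sub>L 'a) \<Rightarrow> complex \<Rightarrow> ('a \<Rightarrow>\<^sub>L 'a)" where
  "resolvent T \<zeta> = (THE S. is_blinfun_inverse (\<zeta> *\<^sub>C id_blinfun - T) S)"

definition spectral_radius :: "('a::complex_banach \<Rightarrow>\<^sub>L 'a) \<Rightarrow> real" where
  "spectral_radius T = (SUP \<zeta>\<in>spectrum T. cmod \<zeta>)"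

definition eigenvalue :: "('a::complex_banach \<Rightarrow>\<^sub>L 'a) \<Rightarrow> complex \<Rightarrow> bool" where
  "eigenvalue T \<mu> \<longleftrightarrow> (\<exists>v. v \<noteq> 0 \<and> blinfun_apply T v = \<mu> *\<^sub>C v)"

text \<open>
  The Riesz projection
  \<open>1 / (2 \<pi> \<i>) \<cdot> \<integral> (\<zeta> - T)\<^sup>-\<^sup>1 d\<zeta>\<close> over the circle \<open>\<zeta> = \<mu> + r exp (\<i> \<phi>)\<close>, \<open>0 \<le> \<phi> \<le> 2 \<pi>\<close>.
  It is meant for \<open>\<mu>\<close> isolated in the spectrum; then any \<open>r > 0\<close> such that \<open>\<mu>\<close> is the only
  spectral point in the closed disc gives the same operator, and one of them is chosen.
\<close>

definition eigenprojection ::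
  "('a::complex_banach \<Rightarrow>\<^sub>L 'a) \<Rightarrow> complex \<Rightarrow> ('a \<Rightarrow>\<^sub>L 'a)" where
  "eigenprojection T \<mu> =
     (let r = (SOME r. 0 < r \<and> spectrum T \<inter> cball \<mu> r \<subseteq> {\<mu>})
      in (1 / (2 * pi)) *\<^sub>R
           integral {0..2 * pi} (\<lambda>\<phi>. (of_real r * cis \<phi>) *\<^sub>C resolvent T (\<mu> + of_real r * cis \<phi>)))"

text \<open>Simple means of algebraic multiplicity one, i.e. the range of the eigenprojection is a line.\<close>

definition isolated_simple_eigenvalue ::
  "('a::complex_banach \<Rightarrow>\<^sub>L 'a) \<Rightarrow> complex \<Rightarrow> bool" where
  "isolated_simple_eigenvalue T \<mu> \<longleftrightarrow>
     eigenvalue T \<mu> \<and> \<mu> isolated_in spectrum T \<and>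
     (\<exists>v. v \<noteq> 0 \<and> range (blinfun_apply (eigenprojection T \<mu>)) = range (\<lambda>c. c *\<^sub>C v))"

definition simple_top_eigenvalue ::
  "('a::complex_banach \<Rightarrow>\<^sub>L 'a) \<Rightarrow> complex \<Rightarrow> bool" where
  "simple_top_eigenvalue T \<mu> \<longleftrightarrow>
     isolated_simple_eigenvalue T \<mu> \<and>
     (\<exists>\<rho>. 0 \<le> \<rho> \<and> \<rho> < cmod \<mu> \<and> spectrum T - {\<mu>} \<subseteq> cball 0 \<rho>)"

text \<open>There is at most one simple top eigenvalue; \<open>top_eigenvalue\<close> is meant for \<open>T\<close> that have one.\<close>

definition top_eigenvalue :: "('a::complex_banach \<Rightarrow>\<^sub>L 'a) \<Rightarrow> complex" where
  "top_eigenvalue T = (THE \<mu>. simple_top_eigenvalue T \<mu>)"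

definition top_eigenprojection :: "('a::complex_banach \<Rightarrow>\<^sub>L 'a) \<Rightarrow> ('a \<Rightarrow>\<^sub>L 'a)" where
  "top_eigenprojection T = eigenprojection T (top_eigenvalue T)"

definition blinfun_power :: "('a::real_normed_vector \<Rightarrow>\<^sub>L 'a) \<Rightarrow> nat \<Rightarrow> ('a \<Rightarrow>\<^sub>L 'a)" where
  "blinfun_power T n = ((\<lambda>S. T o\<^sub>L S) ^^ n) id_blinfun"


section \<open>The semigroups and the conditions (D1), (D2)\<close>

text \<open>
  Throughout, \<open>L z t\<close> is only meaningful for \<open>\<bar>Re z\<bar> < \<delta>\<close> and \<open>t \<ge> 0\<close>.
\<close>

definition operator_semigroups ::
  "real \<Rightarrow> (complex \<Rightarrow> real \<Rightarrow> ('a::complex_banach \<Rightarrow>\<^sub>L 'a)) \<Rightarrow> bool" where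
  "operator_semigroups \<delta> L \<longleftrightarrow>
     (\<forall>z. \<bar>Re z\<bar> < \<delta> \<longrightarrow>
        (\<forall>t\<ge>0. complex_linear (L z t)) \<and>
        (\<forall>t1\<ge>0. \<forall>t2\<ge>0. L z (t1 + t2) = L z t1 o\<^sub>L L z t2) \<and>
        L z 0 = id_blinfun \<and>
        (L z \<longlongrightarrow> id_blinfun) (at_right 0))"

definition condition_B1 ::
  "real \<Rightarrow> (complex \<Rightarrow> real \<Rightarrow> ('a::complex_banach \<Rightarrow>\<^sub>L 'a)) \<Rightarrow> real \<Rightarrow> bool" where
  "condition_B1 \<delta> L \<eta> \<longleftrightarrow>
     continuous_on {z. \<bar>Re z\<bar> < \<delta>} (\<lambda>z. L z (1 + \<eta>)) \<and>
     (\<lambda>z. L z (1 + \<eta>)) vholomorphic_on ball 0 \<delta>"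

definition condition_B2 ::
  "real \<Rightarrow> (complex \<Rightarrow> real \<Rightarrow> ('a::complex_banach \<Rightarrow>\<^sub>L 'a)) \<Rightarrow> real \<Rightarrow> bool" where
  "condition_B2 \<delta> L \<eta> \<longleftrightarrow>
     (\<forall>\<theta>::real. \<bar>\<theta>\<bar> < \<delta> \<longrightarrow>
        (\<exists>\<mu>::real. 0 < \<mu> \<and> simple_top_eigenvalue (L (of_real \<theta>) (1 + \<eta>)) (of_real \<mu>))) \<and>
     top_eigenvalue (L 0 (1 + \<eta>)) = 1"

definition condition_B3 ::
  "real \<Rightarrow> (complex \<Rightarrow> real \<Rightarrow> ('a::complex_banach \<Rightarrow>\<^sub>L 'a)) \<Rightarrow> real \<Rightarrow> bool" where
  "condition_B3 \<delta> L \<eta> \<longleftrightarrow>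
     (\<forall>\<theta>::real. \<bar>\<theta>\<bar> < \<delta> \<longrightarrow> (\<forall>s::real. s \<noteq> 0 \<longrightarrow>
        spectrum (L (Complex \<theta> s) (1 + \<eta>))
          \<subseteq> {z. cmod z < Re (top_eigenvalue (L (of_real \<theta>) (1 + \<eta>)))}))"

text \<open>
  In (B3) and below, \<open>Re\<close> only turns the eigenvalue \<open>top_eigenvalue (L (of_real \<theta>) (1 + \<eta>))\<close>, which
  is a positive real by (B2), into an element of type \<open>real\<close>.
\<close>

definition condition_D1 ::
  "real \<Rightarrow> (complex \<Rightarrow> real \<Rightarrow> ('a::complex_banach \<Rightarrow>\<^sub>L 'a)) \<Rightarrow> bool" where
  "condition_D1 \<delta> L \<longleftrightarrow>
     (\<forall>\<eta>\<in>{0..1}. condition_B1 \<delta> L \<eta> \<and> condition_B2 \<delta> L \<eta> \<and> condition_B3 \<delta> L \<eta>) \<and>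
     (\<forall>\<theta>::real. \<bar>\<theta>\<bar> < \<delta> \<longrightarrow>
        (\<exists>r\<^sub>1>0. \<exists>r\<^sub>2>0. \<exists>K>0. \<exists>N\<^sub>0>0. \<forall>t>N\<^sub>0. \<forall>s. K < \<bar>s\<bar> \<and> \<bar>s\<bar> < t powr r\<^sub>1 \<longrightarrow>
           norm (L (Complex \<theta> s) t)
             \<le> Re (top_eigenvalue (L (of_real \<theta>) 1)) powr t / t powr r\<^sub>2))"

definition condition_D2 ::
  "real \<Rightarrow> (complex \<Rightarrow> real \<Rightarrow> ('a::complex_banach \<Rightarrow>\<^sub>L 'a)) \<Rightarrow> bool" where
  "condition_D2 \<delta> L \<longleftrightarrow>
     (\<forall>z. \<bar>Re z\<bar> < \<delta> \<longrightarrow>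
        (\<forall>\<eta>\<in>{0..1}. \<exists>\<mu>. simple_top_eigenvalue (L z (1 + \<eta>)) \<mu>) \<longrightarrow>
        (\<forall>\<eta>\<in>{0..1}. top_eigenprojection (L z (1 + \<eta>)) = top_eigenprojection (L z 1)))"

end

theory Submission
  imports Defs
begin

text \<open>
  The idea of the proof is that a simple top eigenvalue at time \<open>1\<close> propagates to all times by the
  semigroup law, so that perturbation theory is needed for the single operator \<open>L z 1\<close> only.

  A simple top eigenvalue \<open>\<mu>\<close> of a complex-linear \<open>T\<close> is equivalent to a rank one projection \<open>p\<close> with
  \<open>T p = p T = \<mu> p\<close> such that the powers of \<open>T (1 - p)\<close> are bounded by a geometric sequence of ratio less
  than \<open>\<bar>\<mu>\<bar>\<close> (\<open>simple_top_eigenvalue_imp_dominant\<close>, \<open>dominant_imp_simple_top_eigenvalue\<close>). One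
  direction is the spectral radius formula, the other computes the Riesz projection from the
  decomposition of the resolvent along \<open>p\<close>. Both rest on the fact that the mean of a holomorphic function over
  a circle does not depend on the radius (\<open>circle_mean_radius_indep\<close>).

  This description is stable (\<open>dominant_stable\<close>): some power of \<open>T / \<mu>\<close> is close to \<open>p\<close>, hence so is the
  same power of a nearby \<open>T'\<close>, and a Newton iteration turns it into a projection that commutes with \<open>T'\<close>.
  So \<open>L z 1\<close>, for \<open>z = Complex \<theta> s\<close> with small \<open>s\<close>, has a simple top eigenvalue, and its projection is
  close to that of \<open>L \<theta> 1\<close>.

  For such \<open>z\<close> every \<open>L z t\<close> commutes with \<open>L z 1\<close>, hence with \<open>p\<close>, and acts on the range of \<open>p\<close> by a
  scalar. These scalars form a continuous semigroup \<open>exp (t a)\<close>, while the complementary part keeps its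
  geometric bound (\<open>semigroup_dominant\<close>). Thus \<open>exp (t a)\<close> is the simple top eigenvalue of \<open>L z t\<close>, with the
  same projection \<open>p\<close> for all \<open>t > 0\<close>, and \<open>\<Lambda> z t = L z t (1 - p)\<close> inherits the power law.

  It remains to see that \<open>exp (t a)\<close> is the principal power \<open>exp a powr t\<close>, that is,
  \<open>\<bar>Im a\<bar> < pi\<close>. Here the times \<open>1 + \<eta>\<close> with \<open>\<eta> \<in> {0..1}\<close> enter: as \<open>s\<close> tends to \<open>0\<close>, the eigenvalues
  \<open>exp ((1 + \<eta>) a)\<close> converge to positive numbers for every \<open>\<eta>\<close>, which is impossible if \<open>a\<close> keeps a
  large imaginary part (\<open>principal_branch_near_real_parameter\<close>).
\<close>

section \<open>Complex Banach algebras\<close>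

interpretation scaleC: bounded_bilinear "scaleC :: complex \<Rightarrow> 'a \<Rightarrow> 'a::complex_normed_vector"
proof
  fix c d :: complex and x y :: 'a and r :: real
  show "(r *\<^sub>R c) *\<^sub>C x = r *\<^sub>R (c *\<^sub>C x)"
    by (simp add: scaleC_scaleC scaleR_conv_of_real flip: scaleC_of_real)
  show "c *\<^sub>C (r *\<^sub>R x) = r *\<^sub>R (c *\<^sub>C x)"
    by (simp add: scaleC_scaleC mult.commute flip: scaleC_of_real)
  show "\<exists>K. \<forall>a b. norm (a *\<^sub>C (b::'a)) \<le> norm a * norm b * K"
    by (rule exI[of _ 1]) (simp add: norm_scaleC)
qed (simp_all add: scaleC_add_left scaleC_add_right)

lemmas [continuous_intros] = scaleC.continuous_on
lemmas scaleC_simps = scaleC.add_left scaleC.add_right scaleC.diff_left scaleC.diff_right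
  scaleC.minus_left scaleC.minus_right scaleC_scaleC

lemma scaleC_one [simp]: "1 *\<^sub>C x = x"
  using scaleC_of_real[of 1 x] by simp

declare scaleC.zero_left [simp] scaleC.zero_right [simp]

lemma scaleC_eq_0_iff [simp]: "c *\<^sub>C x = 0 \<longleftrightarrow> c = 0 \<or> x = 0"
proof -
  have "c *\<^sub>C x = 0 \<longleftrightarrow> cmod c * norm x = 0"
    by (metis norm_eq_zero norm_scaleC)
  then show ?thesis by simp
qed

lemma scaleC_cancel_right: "c *\<^sub>C x = d *\<^sub>C x \<longleftrightarrow> c = d \<or> x = 0"
  using scaleC_eq_0_iff[of "c - d" x] by (simp add: scaleC.diff_left del: scaleC_eq_0_iff)

lemma scaleR_scaleC: "r *\<^sub>R c *\<^sub>C x = (of_real r * c) *\<^sub>C x"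
  by (simp add: scaleC_scaleC flip: scaleC_of_real)

text \<open>
  The spectral theory below is algebraic, so it is done in a complex unital Banach algebra. The unit
  may vanish and its norm is not normalised to \<open>1\<close>: the operators on the zero space are
  an instance, and the factors \<open>norm 1\<close> in the estimates come from this.
\<close>

class complex_banach_algebra = complex_banach + real_normed_algebra + monoid_mult +
  assumes scaleC_mult_left: "(c *\<^sub>C x) * y = c *\<^sub>C (x * y)"
    and scaleC_mult_right: "x * (c *\<^sub>C y) = c *\<^sub>C (x * y)"

text \<open>
  \<open>is_inverse\<close>, \<open>spec\<close> and \<open>rsv\<close> are the algebra counterparts of \<open>is_blinfun_inverse\<close>, \<open>spectrum\<close>
  and \<open>resolvent\<close>.
\<close>

definition is_inverse :: "'b::{ring, monoid_mult} \<Rightarrow> 'b \<Rightarrow> bool" where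
  "is_inverse x y \<longleftrightarrow> x * y = 1 \<and> y * x = 1"

definition spec :: "'b::complex_banach_algebra \<Rightarrow> complex set" where
  "spec x = {\<zeta>. \<nexists>y. is_inverse (\<zeta> *\<^sub>C 1 - x) y}"

definition rsv :: "'b::complex_banach_algebra \<Rightarrow> complex \<Rightarrow> 'b" where
  "rsv x \<zeta> = (THE y. is_inverse (\<zeta> *\<^sub>C 1 - x) y)"

lemma is_inverse_unique: "is_inverse x y \<Longrightarrow> is_inverse x z \<Longrightarrow> y = z"
  unfolding is_inverse_def by (metis mult.assoc mult_1_left mult_1_right)

lemma rsv_eqI: "is_inverse (\<zeta> *\<^sub>C 1 - x) y \<Longrightarrow> rsv x \<zeta> = y"
  unfolding rsv_def by (rule the_equality) (auto intro: is_inverse_unique)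

lemma not_specI: "is_inverse (\<zeta> *\<^sub>C 1 - x) y \<Longrightarrow> \<zeta> \<notin> spec x"
  by (auto simp: spec_def)

lemma is_inverse_rsv: "\<zeta> \<notin> spec x \<Longrightarrow> is_inverse (\<zeta> *\<^sub>C 1 - x) (rsv x \<zeta>)"
  unfolding spec_def using rsv_eqI by auto

lemma
  assumes "\<zeta> \<notin> spec x"
  shows mult_rsv: "x * rsv x \<zeta> = \<zeta> *\<^sub>C rsv x \<zeta> - 1"
    and rsv_mult: "rsv x \<zeta> * x = \<zeta> *\<^sub>C rsv x \<zeta> - 1"
proof -
  have "(\<zeta> *\<^sub>C 1 - x) * rsv x \<zeta> = 1" "rsv x \<zeta> * (\<zeta> *\<^sub>C 1 - x) = 1"
    using is_inverse_rsv[OF assms] by (simp_all add: is_inverse_def)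
  then have eq: "\<zeta> *\<^sub>C rsv x \<zeta> - x * rsv x \<zeta> = 1" "\<zeta> *\<^sub>C rsv x \<zeta> - rsv x \<zeta> * x = 1"
    by (simp_all add: left_diff_distrib right_diff_distrib scaleC_mult_left scaleC_mult_right)
  show "x * rsv x \<zeta> = \<zeta> *\<^sub>C rsv x \<zeta> - 1"
    using eq(1) by (simp add: algebra_simps)
  show "rsv x \<zeta> * x = \<zeta> *\<^sub>C rsv x \<zeta> - 1"
    using eq(2) by (simp add: algebra_simps)
qed

lemma inverse_commutes:
  assumes "is_inverse x y" and "x * a = a * x"
  shows "y * a = a * y"
proof -
  have "y * a = y * (a * x) * y"
    using assms(1) by (simp add: is_inverse_def mult.assoc)
  also have "\<dots> = (y * x) * a * y"
    by (simp add: assms(2)[symmetric] mult.assoc)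
  finally show ?thesis
    using assms(1) by (simp add: is_inverse_def)
qed

lemma rsv_commutes:
  assumes "\<zeta> \<notin> spec x" and "x * a = a * x"
  shows "rsv x \<zeta> * a = a * rsv x \<zeta>"
  using assms by (intro inverse_commutes[OF is_inverse_rsv])
    (simp_all add: algebra_simps scaleC_mult_left scaleC_mult_right)

lemma resolvent_identity:
  assumes "\<zeta> \<notin> spec x" and "\<omega> \<notin> spec x"
  shows "rsv x \<zeta> - rsv x \<omega> = (\<omega> - \<zeta>) *\<^sub>C (rsv x \<zeta> * rsv x \<omega>)"
proof -
  have "rsv x \<zeta> * (x * rsv x \<omega>) = (rsv x \<zeta> * x) * rsv x \<omega>"
    by (simp add: mult.assoc)
  then show ?thesis
    by (simp add: mult_rsv rsv_mult assms algebra_simps scaleC_mult_left scaleC_mult_right scaleC_simps)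
qed

text \<open>
  By the resolvent identity, a bound at \<open>\<omega>\<close> propagates to every other point of the resolvent set
  near \<open>\<omega>\<close>. This gives continuity of the resolvent without first showing that the resolvent set is open;
  accordingly, derivatives are taken within the resolvent set.
\<close>

lemma rsv_locally_bounded:
  assumes "\<zeta> \<notin> spec x" and "\<omega> \<notin> spec x" and "cmod (\<zeta> - \<omega>) * norm (rsv x \<omega>) \<le> 1/2"
  shows "norm (rsv x \<zeta>) \<le> 2 * norm (rsv x \<omega>)"
proof -
  have "rsv x \<zeta> = rsv x \<omega> + (\<omega> - \<zeta>) *\<^sub>C (rsv x \<zeta> * rsv x \<omega>)"
    using resolvent_identity[OF assms(1,2)] by (simp add: algebra_simps)
  then have "norm (rsv x \<zeta>) \<le> norm (rsv x \<omega>) + cmod (\<omega> - \<zeta>) * norm (rsv x \<zeta> * rsv x \<omega>)"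
    by (metis norm_triangle_ineq norm_scaleC)
  also have "\<dots> \<le> norm (rsv x \<omega>) + cmod (\<zeta> - \<omega>) * (norm (rsv x \<zeta>) * norm (rsv x \<omega>))"
    by (intro add_left_mono mult_mono norm_mult_ineq) (simp_all add: norm_minus_commute)
  also have "cmod (\<zeta> - \<omega>) * (norm (rsv x \<zeta>) * norm (rsv x \<omega>))
      = norm (rsv x \<zeta>) * (cmod (\<zeta> - \<omega>) * norm (rsv x \<omega>))"
    by (simp add: mult_ac)
  also have "\<dots> \<le> norm (rsv x \<zeta>) * (1/2)"
    using assms(3) by (rule mult_left_mono) simp
  finally show ?thesis by simp
qed

lemma continuous_on_rsv: "continuous_on (- spec x) (rsv x)"
  unfolding continuous_on_eq_continuous_within continuous_within
proof
  fix \<omega> assume \<omega>: "\<omega> \<in> - spec x"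
  let ?M = "norm (rsv x \<omega>)"
  let ?F = "at \<omega> within - spec x"
  have lim: "((\<lambda>\<zeta>. cmod (\<zeta> - \<omega>) * c) \<longlongrightarrow> 0) ?F" for c
    by (rule tendsto_eq_intros | simp)+
  have bound: "\<forall>\<^sub>F \<zeta> in ?F. norm (rsv x \<zeta> - rsv x \<omega>) \<le> cmod (\<zeta> - \<omega>) * (2 * ?M * ?M)"
    using order_tendstoD(2)[OF lim, of "1/2" ?M]
  proof (rule eventually_elim2)
    show "\<forall>\<^sub>F \<zeta> in ?F. \<zeta> \<in> - spec x"
      by (simp add: eventually_at_filter)
    fix \<zeta> assume \<zeta>: "\<zeta> \<in> - spec x" and le: "cmod (\<zeta> - \<omega>) * ?M < 1/2"
    have "norm (rsv x \<zeta>) \<le> 2 * ?M"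
      using \<zeta> \<omega> le by (intro rsv_locally_bounded) auto
    then have "norm (rsv x \<zeta> * rsv x \<omega>) \<le> 2 * ?M * ?M"
      by (intro order_trans[OF norm_mult_ineq] mult_right_mono) auto
    then have "cmod (\<omega> - \<zeta>) * norm (rsv x \<zeta> * rsv x \<omega>) \<le> cmod (\<omega> - \<zeta>) * (2 * ?M * ?M)"
      by (rule mult_left_mono) simp
    then show "norm (rsv x \<zeta> - rsv x \<omega>) \<le> cmod (\<zeta> - \<omega>) * (2 * ?M * ?M)"
      using \<zeta> \<omega> by (simp add: resolvent_identity norm_scaleC norm_minus_commute)
  qed simp
  have "((\<lambda>\<zeta>. rsv x \<zeta> - rsv x \<omega>) \<longlongrightarrow> 0) ?F"
    by (rule Lim_null_comparison[OF bound lim])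
  then show "(rsv x \<longlongrightarrow> rsv x \<omega>) ?F"
    by (simp add: LIM_zero_iff)
qed

lemma has_derivative_rsv:
  assumes "\<omega> \<notin> spec x"
  shows "(rsv x has_derivative (\<lambda>h. h *\<^sub>C (- (rsv x \<omega> * rsv x \<omega>)))) (at \<omega> within - spec x)"
proof (rule has_derivativeI_sandwich[of 1])
  let ?F = "at \<omega> within - spec x"
  show "bounded_linear (\<lambda>h. h *\<^sub>C (- (rsv x \<omega> * rsv x \<omega>)))"
    by (rule scaleC.bounded_linear_left)
  show "((\<lambda>\<zeta>. norm (rsv x \<omega> - rsv x \<zeta>) * norm (rsv x \<omega>)) \<longlongrightarrow> 0) ?F"
  proof -
    have "(rsv x \<longlongrightarrow> rsv x \<omega>) ?F"
      using continuous_on_rsv[of x] assms by (auto simp: continuous_on)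
    then have "((\<lambda>\<zeta>. norm (rsv x \<omega> - rsv x \<zeta>) * norm (rsv x \<omega>))
        \<longlongrightarrow> norm (rsv x \<omega> - rsv x \<omega>) * norm (rsv x \<omega>)) ?F"
      by (intro tendsto_intros)
    then show ?thesis by simp
  qed
  fix \<zeta> assume \<zeta>: "\<zeta> \<in> - spec x" "\<zeta> \<noteq> \<omega>"
  have "rsv x \<zeta> - rsv x \<omega> - (\<zeta> - \<omega>) *\<^sub>C (- (rsv x \<omega> * rsv x \<omega>))
      = (\<zeta> - \<omega>) *\<^sub>C ((rsv x \<omega> - rsv x \<zeta>) * rsv x \<omega>)"
    using resolvent_identity[of \<zeta> x \<omega>] \<zeta> assms by (simp add: left_diff_distrib scaleC_simps)
  then show "norm (rsv x \<zeta> - rsv x \<omega> - (\<zeta> - \<omega>) *\<^sub>C (- (rsv x \<omega> * rsv x \<omega>))) / norm (\<zeta> - \<omega>)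
      \<le> norm (rsv x \<omega> - rsv x \<zeta>) * norm (rsv x \<omega>)"
    using \<zeta>(2) norm_mult_ineq[of "rsv x \<omega> - rsv x \<zeta>" "rsv x \<omega>"] by (simp add: norm_scaleC)
qed auto

section \<open>Means over circles\<close>

definition circle_mean :: "complex \<Rightarrow> real \<Rightarrow> (complex \<Rightarrow> 'b::complex_banach) \<Rightarrow> 'b" where
  "circle_mean c r g = (1 / (2 * pi)) *\<^sub>R integral {0..2 * pi} (\<lambda>\<phi>. g (c + of_real r * cis \<phi>))"

lemma integrable_circle:
  fixes g :: "complex \<Rightarrow> 'b::complex_banach"
  assumes "0 \<le> r" and "continuous_on (sphere c r) g"
  shows "(\<lambda>\<phi>. g (c + of_real r * cis \<phi>)) integrable_on {0..2 * pi}"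
  by (intro integrable_continuous_interval continuous_on_compose2[OF assms(2)] continuous_intros)
    (use assms(1) in \<open>auto simp: dist_norm norm_mult\<close>)

lemma circle_mean_cong:
  assumes "0 \<le> r" and "\<And>\<zeta>. cmod (\<zeta> - c) = r \<Longrightarrow> f \<zeta> = g \<zeta>"
  shows "circle_mean c r f = circle_mean c r g"
  unfolding circle_mean_def
  by (intro arg_cong[where f = "scaleR _"] integral_cong assms(2))
    (use assms(1) in \<open>auto simp: norm_mult\<close>)

lemma circle_mean_bounded_linear:
  assumes "bounded_linear h" and "0 \<le> r" and "continuous_on (sphere c r) g"
  shows "circle_mean c r (\<lambda>\<zeta>. h (g \<zeta>)) = h (circle_mean c r g)"
  using integral_linear[OF integrable_circle[OF assms(2,3)] assms(1)]
  by (simp add: circle_mean_def o_def linear_simps(5)[OF assms(1)])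

lemma circle_mean_diff:
  assumes "0 \<le> r" and "continuous_on (sphere c r) f" and "continuous_on (sphere c r) g"
  shows "circle_mean c r (\<lambda>\<zeta>. f \<zeta> - g \<zeta>) = circle_mean c r f - circle_mean c r g"
  using integrable_circle[OF assms(1,2)] integrable_circle[OF assms(1,3)]
  by (simp add: circle_mean_def integral_diff scaleR_diff_right)

lemma circle_mean_add:
  assumes "0 \<le> r" and "continuous_on (sphere c r) f" and "continuous_on (sphere c r) g"
  shows "circle_mean c r (\<lambda>\<zeta>. f \<zeta> + g \<zeta>) = circle_mean c r f + circle_mean c r g"
  using integrable_circle[OF assms(1,2)] integrable_circle[OF assms(1,3)]
  by (simp add: circle_mean_def integral_add scaleR_add_right)

lemma circle_mean_const: "circle_mean c r (\<lambda>_. x) = x"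
  by (simp add: circle_mean_def)

lemma circle_mean_center: "circle_mean c 0 g = g c"
  by (simp add: circle_mean_def)

lemma norm_circle_mean_le:
  assumes "0 \<le> r" and "continuous_on (sphere c r) g" and "\<And>\<zeta>. cmod (\<zeta> - c) = r \<Longrightarrow> norm (g \<zeta>) \<le> B"
  shows "norm (circle_mean c r g) \<le> B"
proof -
  have "norm (integral {0..2 * pi} (\<lambda>\<phi>. g (c + of_real r * cis \<phi>))) \<le> B * (2 * pi - 0)"
    by (intro integral_bound continuous_on_compose2[OF assms(2)] continuous_intros assms(3))
      (use assms(1) in \<open>auto simp: dist_norm norm_mult\<close>)
  then show ?thesis
    by (simp add: circle_mean_def field_simps)
qed

text \<open>
  The radial derivative of the mean is the mean of an angular derivative, up to a scalar factor, and
  the latter integrates to zero over the full circle. This replaces Cauchy's theorem below; the case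
  \<open>s = 0\<close> is the mean value property.
\<close>

lemma circle_mean_radius_indep:
  fixes g :: "complex \<Rightarrow> 'b::complex_banach"
  assumes "0 \<le> s" and "s \<le> r"
    and deriv: "\<And>\<zeta>. \<zeta> \<in> A \<Longrightarrow> (g has_derivative (\<lambda>h. h *\<^sub>C g' \<zeta>)) (at \<zeta> within A)"
    and cont: "continuous_on A g'"
    and sub: "cball c r - ball c s \<subseteq> A"
  shows "circle_mean c s g = circle_mean c r g"
proof -
  let ?p = "\<lambda>\<rho> \<phi>. c + complex_of_real \<rho> * cis \<phi>"
  have inA: "?p \<rho> \<phi> \<in> A" if "\<rho> \<in> {s..r}" for \<rho> \<phi>
    using that assms(1) sub by (auto simp: dist_norm norm_mult)
  have gcont: "continuous_on A g"
    using deriv by (meson differentiable_imp_continuous_on differentiable_def differentiable_on_def)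
  have radial: "((\<lambda>\<rho>. integral (cbox 0 (2 * pi)) (\<lambda>\<phi>. g (?p \<rho> \<phi>))) has_vector_derivative
      integral (cbox 0 (2 * pi)) (\<lambda>\<phi>. cis \<phi> *\<^sub>C g' (?p x \<phi>))) (at x within {s..r})"
    if x: "x \<in> {s..r}" for x
  proof (rule leibniz_rule_vector_derivative)
    fix \<rho> \<phi> assume \<rho>: "\<rho> \<in> {s..r}"
    have "((\<lambda>\<rho>. ?p \<rho> \<phi>) has_derivative (\<lambda>h. of_real h * cis \<phi>)) (at \<rho> within {s..r})"
      by (auto intro!: derivative_eq_intros)
    from has_derivative_in_compose2[OF deriv _ \<rho> this]
    have "((\<lambda>\<rho>. g (?p \<rho> \<phi>)) has_derivative (\<lambda>h. (of_real h * cis \<phi>) *\<^sub>C g' (?p \<rho> \<phi>))) (at \<rho> within {s..r})"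
      using inA by (simp add: image_subset_iff)
    then show "((\<lambda>\<rho>. g (?p \<rho> \<phi>)) has_vector_derivative cis \<phi> *\<^sub>C g' (?p \<rho> \<phi>)) (at \<rho> within {s..r})"
      by (simp add: has_vector_derivative_def scaleR_scaleC)
  next
    fix \<rho> assume "\<rho> \<in> {s..r}"
    then show "(\<lambda>\<phi>. g (?p \<rho> \<phi>)) integrable_on cbox 0 (2 * pi)"
      unfolding cbox_interval using inA
      by (intro integrable_continuous_interval continuous_on_compose2[OF gcont] continuous_intros) auto
  next
    show "continuous_on ({s..r} \<times> cbox 0 (2 * pi)) (\<lambda>(\<rho>, \<phi>). cis \<phi> *\<^sub>C g' (?p \<rho> \<phi>))"
      unfolding case_prod_unfold using inA
      by (intro continuous_intros continuous_on_compose2[OF cont]) auto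
  qed (use x in auto)
  have angular: "integral (cbox 0 (2 * pi)) (\<lambda>\<phi>. cis \<phi> *\<^sub>C g' (?p x \<phi>)) = 0"
    if x: "x \<in> {s..r}" "x \<noteq> 0" for x
  proof -
    have "((\<lambda>\<phi>. (of_real x * \<i> * cis \<phi>) *\<^sub>C g' (?p x \<phi>)) has_integral
        g (?p x (2 * pi)) - g (?p x 0)) {0..2 * pi}"
    proof (rule fundamental_theorem_of_calculus)
      fix \<phi> :: real
      have "((\<lambda>\<phi>. ?p x \<phi>) has_derivative (\<lambda>h. of_real h * (of_real x * \<i> * cis \<phi>)))
          (at \<phi> within {0..2 * pi})"
        by (auto intro!: derivative_eq_intros simp: scaleR_conv_of_real)
      from has_derivative_in_compose2[OF deriv _ _ this]
      have "((\<lambda>\<phi>. g (?p x \<phi>)) has_derivative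
          (\<lambda>h. (of_real h * (of_real x * \<i> * cis \<phi>)) *\<^sub>C g' (?p x \<phi>))) (at \<phi> within {0..2 * pi})"
        if "\<phi> \<in> {0..2 * pi}"
        using inA that x(1) by auto
      then show "((\<lambda>\<phi>. g (?p x \<phi>)) has_vector_derivative (of_real x * \<i> * cis \<phi>) *\<^sub>C g' (?p x \<phi>))
          (at \<phi> within {0..2 * pi})" if "\<phi> \<in> {0..2 * pi}"
        using that by (simp add: has_vector_derivative_def scaleR_scaleC)
    qed simp
    moreover define k where "k = complex_of_real x * \<i>"
    ultimately have "((\<lambda>\<phi>. k *\<^sub>C (cis \<phi> *\<^sub>C g' (?p x \<phi>))) has_integral 0) {0..2 * pi}"
      by (simp add: scaleC_scaleC)
    from has_integral_linear[OF this scaleC.bounded_linear_right[of "inverse k"]]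
    have "((\<lambda>\<phi>. (inverse k * k) *\<^sub>C (cis \<phi> *\<^sub>C g' (?p x \<phi>))) has_integral 0) {0..2 * pi}"
      by (simp only: o_def scaleC_scaleC[of "inverse k" k] scaleC.zero_right)
    moreover have "inverse k * k = 1"
      using x(2) unfolding k_def by (intro left_inverse) simp
    ultimately show ?thesis
      by (simp add: integral_unique)
  qed
  have "integral {0..2 * pi} (\<lambda>\<phi>. g (?p s \<phi>)) = integral {0..2 * pi} (\<lambda>\<phi>. g (?p r \<phi>))"
  proof (cases "s = r")
    case False
    with assms have "s < r" by simp
    let ?G = "\<lambda>\<rho>. integral {0..2 * pi} (\<lambda>\<phi>. g (?p \<rho> \<phi>))"
    have "?G r = ?G s"
    proof (rule has_derivative_zero_unique_strong_interval[of "{s}" s r])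
      show "continuous_on {s..r} ?G"
        using has_vector_derivative_continuous[OF radial]
        by (simp add: continuous_on_eq_continuous_within)
      fix x assume x: "x \<in> {s..r} - {s}"
      then show "(?G has_derivative (\<lambda>h. 0)) (at x within {s..r})"
        using radial[of x] angular[of x] assms(1) by (auto simp: has_vector_derivative_def)
    qed (use \<open>s < r\<close> in auto)
    then show ?thesis by simp
  qed simp
  then show ?thesis
    by (simp add: circle_mean_def)
qed

section \<open>Powers and the spectral radius\<close>

lemma scaleC_power: "(c *\<^sub>C x) ^ n = c ^ n *\<^sub>C (x ^ n)" for x :: "'b::complex_banach_algebra"
  by (induction n) (simp_all add: scaleC_mult_left scaleC_mult_right scaleC_scaleC mult.commute)

lemma norm_power_le: "norm (x ^ n) \<le> norm (1::'b) * norm x ^ n" for x :: "'b::complex_banach_algebra"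
proof (induction n)
  case (Suc n)
  have "norm (x ^ Suc n) \<le> norm x * norm (x ^ n)"
    by (simp add: norm_mult_ineq)
  also have "\<dots> \<le> norm x * (norm (1::'b) * norm x ^ n)"
    by (intro mult_left_mono Suc) simp
  finally show ?case by (simp add: mult_ac)
qed simp

lemma geometric_sum_left: "(1 - x) * (\<Sum>i<n. x ^ i) = 1 - x ^ n" for x :: "'b::{ring, monoid_mult}"
proof (induction n)
  case (Suc n)
  then show ?case
    by (simp only: sum.lessThan_Suc distrib_left) (simp add: left_diff_distrib)
qed simp

lemma geometric_sum_right: "(\<Sum>i<n. x ^ i) * (1 - x) = 1 - x ^ n" for x :: "'b::{ring, monoid_mult}"
proof (induction n)
  case (Suc n)
  then show ?case
    by (simp only: sum.lessThan_Suc distrib_right) (simp add: right_diff_distrib power_commutes)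
qed simp

lemma neumann_series:
  fixes x :: "'b::complex_banach_algebra"
  assumes "norm x < 1"
  shows "\<exists>y. is_inverse (1 - x) y"
proof -
  have "summable (\<lambda>n. norm (1::'b) * norm x ^ n)"
    using assms by (intro summable_mult summable_geometric) simp
  then have sm: "summable (\<lambda>n. x ^ n)"
    by (rule summable_comparison_test') (rule norm_power_le)
  then have zero: "(\<lambda>n. x ^ n) \<longlonglongrightarrow> 0"
    by (rule summable_LIMSEQ_zero)
  let ?y = "\<Sum>n. x ^ n"
  have y: "(\<lambda>n. \<Sum>i<n. x ^ i) \<longlonglongrightarrow> ?y"
    by (rule summable_LIMSEQ[OF sm])
  have one: "(\<lambda>n. 1 - x ^ n) \<longlonglongrightarrow> 1"
    using tendsto_diff[OF tendsto_const zero, of 1] by simp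
  have "(1 - x) * ?y = 1"
    using tendsto_mult_left[OF y, of "1 - x"] one
    by (auto simp: geometric_sum_left intro: LIMSEQ_unique)
  moreover have "?y * (1 - x) = 1"
    using tendsto_mult_right[OF y, of "1 - x"] one
    by (auto simp: geometric_sum_right intro: LIMSEQ_unique)
  ultimately show ?thesis
    by (auto simp: is_inverse_def)
qed

text \<open>
  If \<open>b\<close> is \<open>a\<close> divided by \<open>\<zeta>\<close>, then \<open>1 - b ^ n\<close> is invertible by the Neumann series, and it is the
  product of \<open>1 - b\<close> with a geometric sum that commutes with everything involved; so \<open>1 - b\<close> is
  invertible too.
\<close>

lemma not_spec_of_power:
  fixes a :: "'b::complex_banach_algebra"
  assumes "norm (a ^ n) < cmod \<zeta> ^ n" and "\<zeta> \<noteq> 0"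
  shows "\<zeta> \<notin> spec a"
proof -
  let ?b = "inverse \<zeta> *\<^sub>C a" and ?S = "\<Sum>i<n. (inverse \<zeta> *\<^sub>C a) ^ i"
  have "norm (?b ^ n) < 1"
    using assms by (simp add: scaleC_power norm_scaleC norm_power norm_inverse norm_divide field_simps)
  then obtain y where y: "is_inverse (1 - ?b ^ n) y"
    using neumann_series by blast
  have "y * (1 - ?b) = (1 - ?b) * y"
    using y by (rule inverse_commutes)
      (simp add: algebra_simps power_commutes)
  then have "y * ?b = ?b * y"
    by (simp add: algebra_simps)
  then have "y * ?b ^ i = ?b ^ i * y" for i
    by (metis power_commuting_commutes)
  then have comm: "y * ?S = ?S * y"
    by (simp add: sum_distrib_left sum_distrib_right)
  have "(1 - ?b) * (?S * y) = 1"
    using y by (simp add: is_inverse_def geometric_sum_left flip: mult.assoc)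
  moreover have "(?S * y) * (1 - ?b) = 1"
    using y by (simp add: is_inverse_def geometric_sum_right mult.assoc flip: comm)
  moreover have "\<zeta> *\<^sub>C 1 - a = \<zeta> *\<^sub>C (1 - ?b)"
    using assms(2) by (simp add: scaleC_simps)
  ultimately have "is_inverse (\<zeta> *\<^sub>C 1 - a) (inverse \<zeta> *\<^sub>C (?S * y))"
    using assms(2) by (simp add: is_inverse_def scaleC_mult_left scaleC_mult_right scaleC_scaleC)
  then show ?thesis
    by (rule not_specI)
qed

text \<open>
  For \<open>m > 0\<close> this says that the spectral radius of \<open>a\<close> is less than \<open>m\<close>, in the form of a bound on
  powers. It is the notion that passes from \<open>L z 1\<close> to \<open>L z t\<close> along a semigroup.
\<close>

definition geometric_below :: "'b::complex_banach_algebra \<Rightarrow> real \<Rightarrow> bool" where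
  "geometric_below a m \<longleftrightarrow> (\<exists>C r. 0 < r \<and> r < m \<and> (\<forall>n. norm (a ^ n) \<le> C * r ^ n))"

lemma geometric_below_eventually:
  assumes "geometric_below a m" and "0 < e"
  shows "\<forall>\<^sub>F n in sequentially. norm (a ^ n) < e * m ^ n"
proof -
  from assms(1) obtain C r where r: "0 < r" "r < m" and le: "\<And>n. norm (a ^ n) \<le> C * r ^ n"
    unfolding geometric_below_def by auto
  have "(\<lambda>n. C * (r / m) ^ n) \<longlonglongrightarrow> C * 0"
    using r by (intro tendsto_intros LIMSEQ_realpow_zero) auto
  then have "\<forall>\<^sub>F n in sequentially. C * (r / m) ^ n < e"
    using assms(2) by (intro order_tendstoD(2)) auto
  then show ?thesis
  proof eventually_elim
    case (elim n)
    then have "C * r ^ n < e * m ^ n"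
      using r by (simp add: power_divide field_simps)
    with le[of n] show ?case by simp
  qed
qed

text \<open>
  A single small power suffices: write an exponent as \<open>N * k + j\<close> with \<open>j < N\<close>. The rate \<open>r\<close> is chosen
  with \<open>r ^ N\<close> midway between \<open>norm (a ^ N)\<close> and \<open>m ^ N\<close>, so that it is positive even if the power vanishes.
\<close>

lemma geometric_below_of_power:
  fixes a :: "'b::complex_banach_algebra"
  assumes "norm (a ^ N) < m ^ N" and "N \<ge> 1" and "0 < m"
  shows "geometric_below a m"
proof -
  define r where "r = root N ((norm (a ^ N) + m ^ N) / 2)"
  have rN: "r ^ N = (norm (a ^ N) + m ^ N) / 2"
    using assms by (simp add: r_def)
  have r: "0 < r" "r < m"
    using assms real_root_less_mono[of N "(norm (a ^ N) + m ^ N) / 2" "m ^ N"]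
    by (auto simp: r_def real_root_power_cancel add_nonneg_pos)
  have aN: "norm (a ^ N) \<le> r ^ N"
    using assms(1) by (simp add: rN)
  define C where "C = norm (1::'b) * (\<Sum>j<N. norm (a ^ j) / r ^ j)"
  have "norm (a ^ n) \<le> C * r ^ n" for n
  proof -
    obtain k j where n: "n = N * k + j" and "j < N"
      using assms(2) by (metis div_mult_mod_eq mod_less_divisor mult.commute less_le_trans zero_less_one)
    have j: "norm (a ^ j) / r ^ j \<le> (\<Sum>j<N. norm (a ^ j) / r ^ j)"
      using r \<open>j < N\<close> by (intro member_le_sum[of j "{..<N}" "\<lambda>j. norm (a ^ j) / r ^ j"]) auto
    have "norm (a ^ n) = norm ((a ^ N) ^ k * a ^ j)"
      by (subst n) (simp only: power_add power_mult)
    also have "\<dots> \<le> (norm (1::'b) * (r ^ N) ^ k) * norm (a ^ j)"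
      by (intro order_trans[OF norm_mult_ineq] mult_right_mono order_trans[OF norm_power_le]
          mult_left_mono power_mono aN) auto
    also have "\<dots> = (norm (1::'b) * (norm (a ^ j) / r ^ j)) * r ^ (N * k + j)"
      using r by (simp add: power_add power_mult)
    also have "\<dots> \<le> C * r ^ n"
      unfolding C_def n[symmetric] using r j by (intro mult_right_mono mult_left_mono) auto
    finally show ?thesis .
  qed
  then show ?thesis
    unfolding geometric_below_def using r by blast
qed

lemma geometric_below_spec:
  assumes "geometric_below a m"
  shows "\<exists>\<rho>. 0 \<le> \<rho> \<and> \<rho> < m \<and> spec a \<subseteq> cball 0 \<rho>"
proof -
  from assms obtain C r where r: "0 < r" "r < m" and le: "\<And>n. norm (a ^ n) \<le> C * r ^ n"
    unfolding geometric_below_def by auto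
  have "\<zeta> \<notin> spec a" if "r < cmod \<zeta>" for \<zeta>
  proof -
    have "geometric_below a (cmod \<zeta>)"
      unfolding geometric_below_def using r le that by blast
    from geometric_below_eventually[OF this, of 1]
    obtain n where "norm (a ^ n) < cmod \<zeta> ^ n"
      by (auto simp: eventually_sequentially)
    then show ?thesis
      using that r by (intro not_spec_of_power) auto
  qed
  then show ?thesis
    using r by (intro exI[of _ r]) (auto simp: not_less[symmetric])
qed

lemma power_rsv_mean_indep:
  fixes a :: "'b::complex_banach_algebra"
  assumes "0 \<le> s" and "s \<le> r" and "cball c r - ball c s \<subseteq> - spec a"
  shows "circle_mean c s (\<lambda>\<zeta>. (\<zeta> - w) ^ m *\<^sub>C rsv a \<zeta>) = circle_mean c r (\<lambda>\<zeta>. (\<zeta> - w) ^ m *\<^sub>C rsv a \<zeta>)"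
proof (rule circle_mean_radius_indep[OF assms(1,2) _ _ assms(3)])
  let ?D = "\<lambda>\<zeta>. (of_nat m * (\<zeta> - w) ^ (m - 1)) *\<^sub>C rsv a \<zeta>
    + (\<zeta> - w) ^ m *\<^sub>C (- (rsv a \<zeta> * rsv a \<zeta>))"
  show "continuous_on (- spec a) ?D"
    by (intro continuous_intros continuous_on_rsv)
  fix \<zeta> assume "\<zeta> \<in> - spec a"
  moreover have "((\<lambda>\<zeta>. (\<zeta> - w) ^ m) has_derivative (\<lambda>h. h * (of_nat m * (\<zeta> - w) ^ (m - 1))))
      (at \<zeta> within - spec a)"
    by (auto intro!: derivative_eq_intros simp: fun_eq_iff)
  ultimately show "((\<lambda>\<zeta>. (\<zeta> - w) ^ m *\<^sub>C rsv a \<zeta>) has_derivative (\<lambda>h. h *\<^sub>C ?D \<zeta>)) (at \<zeta> within - spec a)"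
    using scaleC.FDERIV[OF _ has_derivative_rsv]
    by (auto elim!: has_derivative_eq_rhs simp: fun_eq_iff scaleC_simps mult_ac add.commute)
qed

lemma power_mean_zero:
  "0 \<le> r \<Longrightarrow> circle_mean 0 r (\<lambda>\<zeta>. \<zeta> ^ m *\<^sub>C (1::'b::complex_banach_algebra)) = (if m = 0 then 1 else 0)"
proof -
  assume "0 \<le> r"
  have "circle_mean 0 0 (\<lambda>\<zeta>. \<zeta> ^ m *\<^sub>C (1::'b)) = circle_mean 0 r (\<lambda>\<zeta>. \<zeta> ^ m *\<^sub>C (1::'b))"
  proof (rule circle_mean_radius_indep[where A = UNIV, OF _ \<open>0 \<le> r\<close>])
    show "continuous_on UNIV (\<lambda>\<zeta>. (of_nat m * \<zeta> ^ (m - 1)) *\<^sub>C (1::'b))"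
      by (intro continuous_intros)
    fix \<zeta> :: complex
    have "((\<lambda>\<zeta>. \<zeta> ^ m) has_derivative (\<lambda>h. h * (of_nat m * \<zeta> ^ (m - 1)))) (at \<zeta> within UNIV)"
      by (auto intro!: derivative_eq_intros simp: fun_eq_iff)
    from bounded_linear.has_derivative[OF scaleC.bounded_linear_left[of "1::'b"] this]
    show "((\<lambda>\<zeta>. \<zeta> ^ m *\<^sub>C (1::'b)) has_derivative (\<lambda>h. h *\<^sub>C (of_nat m * \<zeta> ^ (m - 1)) *\<^sub>C 1)) (at \<zeta> within UNIV)"
      by (simp add: scaleC_scaleC)
  qed auto
  then show ?thesis
    by (cases m) (simp_all add: circle_mean_center)
qed

text \<open>
  The nontrivial half of the spectral radius formula. The idea is to write \<open>a ^ k\<close> as the mean of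
  \<open>\<zeta> ^ Suc k *\<^sub>C rsv a \<zeta>\<close> over any circle that surrounds the spectrum, and to shrink the circle to
  a radius below \<open>m\<close>. With \<open>E k\<close> the mean of \<open>\<zeta> ^ k *\<^sub>C rsv a \<zeta>\<close>, the relation
  \<open>\<zeta> *\<^sub>C rsv a \<zeta> = 1 + a * rsv a \<zeta>\<close> gives the recursion \<open>E (Suc k) = a * E k\<close>, with an additional
  \<open>1\<close> for \<open>k = 0\<close>; and \<open>E 0 = 0\<close> since the resolvent tends to zero on large circles.
\<close>

lemma spec_geometric_below:
  fixes a :: "'b::complex_banach_algebra"
  assumes "spec a \<subseteq> cball 0 \<rho>" and "0 \<le> \<rho>" and "\<rho> < m"
  shows "geometric_below a m"
proof -
  define r where "r = (\<rho> + m) / 2"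
  have r: "0 < r" "r < m" "\<rho> < r"
    using assms by (auto simp: r_def field_simps)
  define E where "E k = circle_mean 0 r (\<lambda>\<zeta>. \<zeta> ^ k *\<^sub>C rsv a \<zeta>)" for k
  have sub: "cball 0 R - ball 0 r \<subseteq> - spec a" for R
    using assms(1) r by auto
  have sphere_sub: "sphere 0 R \<subseteq> - spec a" if "r \<le> R" for R
    using assms(1) r that by auto
  have E_R: "E k = circle_mean 0 R (\<lambda>\<zeta>. \<zeta> ^ k *\<^sub>C rsv a \<zeta>)" if "r \<le> R" for k R
    using power_rsv_mean_indep[of r R 0 a 0 k] that r sub by (simp add: E_def)
  have cont: "continuous_on (sphere 0 R) (\<lambda>\<zeta>. \<zeta> ^ k *\<^sub>C rsv a \<zeta>)" if "r \<le> R" for k R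
    by (intro continuous_intros continuous_on_subset[OF continuous_on_rsv sphere_sub[OF that]])
  have E0: "E 0 = 0"
  proof -
    have "norm (E 0) \<le> e" if "0 < e" for e
    proof -
      \<comment> \<open>On the circle of radius \<open>R\<close>, the resolvent has norm at most \<open>norm 1 / (R - norm a)\<close>.\<close>
      define R where "R = max r (norm a + norm (1::'b) / e + 1)"
      have "norm (rsv a \<zeta>) \<le> e" if \<zeta>: "cmod \<zeta> = R" for \<zeta>
      proof -
        have "\<zeta> \<notin> spec a"
          using sphere_sub[of R] \<zeta> by (auto simp: R_def)
        from mult_rsv[OF this] have "\<zeta> *\<^sub>C rsv a \<zeta> = 1 + a * rsv a \<zeta>"
          by simp
        then have "R * norm (rsv a \<zeta>) \<le> norm (1::'b) + norm (a * rsv a \<zeta>)"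
          by (metis \<zeta> norm_scaleC norm_triangle_ineq)
        also have "\<dots> \<le> norm (1::'b) + norm a * norm (rsv a \<zeta>)"
          by (simp add: norm_mult_ineq)
        finally have le: "(R - norm a) * norm (rsv a \<zeta>) \<le> norm (1::'b)"
          by (simp add: algebra_simps)
        have pos: "norm (1::'b) / e < R - norm a"
          by (simp add: R_def max_def)
        then have "norm (1::'b) < (R - norm a) * e"
          using that \<open>0 < e\<close> by (simp add: field_simps)
        moreover have "0 < R - norm a"
          using pos \<open>0 < e\<close> by (meson divide_nonneg_pos le_less_trans norm_ge_zero)
        ultimately show ?thesis
          using le by (smt (verit) mult_less_cancel_left_pos)
      qed
      then show ?thesis
        using norm_circle_mean_le[of R 0 "\<lambda>\<zeta>. \<zeta> ^ 0 *\<^sub>C rsv a \<zeta>" e] cont[of R 0] r E_R[of R 0]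
        by (simp add: R_def)
    qed
    then have "norm (E 0) \<le> 0"
      by (meson dense_ge not_le)
    then show ?thesis by simp
  qed
  have E_Suc: "E (Suc k) = a * E k + (if k = 0 then 1 else 0)" for k
  proof -
    have "E (Suc k) = circle_mean 0 r (\<lambda>\<zeta>. a * (\<zeta> ^ k *\<^sub>C rsv a \<zeta>) + \<zeta> ^ k *\<^sub>C 1)"
      unfolding E_def
    proof (rule circle_mean_cong)
      fix \<zeta> assume "cmod (\<zeta> - 0) = r"
      then have "\<zeta> \<notin> spec a"
        using sphere_sub[of r] by auto
      then show "\<zeta> ^ Suc k *\<^sub>C rsv a \<zeta> = a * \<zeta> ^ k *\<^sub>C rsv a \<zeta> + \<zeta> ^ k *\<^sub>C 1"
        by (simp add: scaleC_mult_right mult_rsv scaleC_simps mult.commute)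
    qed (use r in simp)
    also have "\<dots> = circle_mean 0 r (\<lambda>\<zeta>. a * (\<zeta> ^ k *\<^sub>C rsv a \<zeta>)) + circle_mean 0 r (\<lambda>\<zeta>. \<zeta> ^ k *\<^sub>C 1)"
      using r by (intro circle_mean_add continuous_intros cont) auto
    also have "circle_mean 0 r (\<lambda>\<zeta>. a * (\<zeta> ^ k *\<^sub>C rsv a \<zeta>)) = a * E k"
      unfolding E_def using r by (intro circle_mean_bounded_linear bounded_linear_mult_right cont) auto
    finally show ?thesis
      using r by (simp add: power_mean_zero)
  qed
  have E_power: "E (Suc k) = a ^ k" for k
    by (induction k) (simp_all add: E_Suc E0)
  have "bounded (rsv a ` sphere 0 r)"
    by (intro compact_imp_bounded compact_continuous_image compact_sphere
        continuous_on_subset[OF continuous_on_rsv sphere_sub]) simp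
  then obtain M where "\<forall>\<zeta>\<in>sphere 0 r. norm (rsv a \<zeta>) \<le> M"
    by (auto simp: bounded_iff)
  then have M: "norm (rsv a \<zeta>) \<le> M" if "cmod \<zeta> = r" for \<zeta>
    using that by simp
  have "norm (a ^ k) \<le> (r * M) * r ^ k" for k
  proof -
    have "norm (circle_mean 0 r (\<lambda>\<zeta>. \<zeta> ^ Suc k *\<^sub>C rsv a \<zeta>)) \<le> r ^ Suc k * M"
      using r M by (intro norm_circle_mean_le cont)
        (auto simp: norm_scaleC norm_mult norm_power mult_left_mono simp del: power_Suc)
    then show ?thesis
      unfolding E_def[symmetric] E_power by (simp add: mult_ac)
  qed
  then show ?thesis
    unfolding geometric_below_def using r by blast
qed

section \<open>Idempotents\<close>

text \<open>
  The algebra splits along \<open>p\<close> and \<open>1 - p\<close>; an element commuting with \<open>p\<close> may be replaced on the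
  \<open>p\<close>-part by a nonzero scalar. Here \<open>y\<close> inverts \<open>x\<close> on the part
  \<open>1 - p\<close>. This serves to move the eigenvalue of an operator on the range of its spectral
  projection out of the way.
\<close>

lemma is_inverse_compress:
  fixes x y p :: "'b::complex_banach_algebra"
  assumes "p * p = p" and "x * p = p * x" and "y * p = p * y"
    and "x * y * (1 - p) = 1 - p" and "y * x * (1 - p) = 1 - p" and "d \<noteq> 0"
  shows "is_inverse (x * (1 - p) + d *\<^sub>C p) (y * (1 - p) + inverse d *\<^sub>C p)"
proof -
  have q: "p * (1 - p) = 0" "(1 - p) * p = 0" "(1 - p) * (1 - p) = 1 - p"
    using assms(1) by (simp_all add: algebra_simps)
  have comm: "(1 - p) * x = x * (1 - p)" "(1 - p) * y = y * (1 - p)"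
    using assms(2,3) by (simp_all add: algebra_simps)
  have *: "(u * (1 - p) + e *\<^sub>C p) * (v * (1 - p) + f *\<^sub>C p) = 1"
    if "(1 - p) * v = v * (1 - p)" "v * p = p * v" "u * v * (1 - p) = 1 - p" "e * f = 1" for u v e f
  proof -
    have "u * (1 - p) * (v * (1 - p)) = 1 - p"
      using that(1,3) q(3) by (metis mult.assoc)
    moreover have "u * (1 - p) * p = 0"
      using q(2) by (simp add: mult.assoc)
    moreover have "p * (v * (1 - p)) = 0"
      using that(2) q(1) by (metis mult.assoc mult_zero_right)
    moreover have "f * e = 1"
      using that(4) by (simp add: mult.commute)
    ultimately show ?thesis
      using assms(1)
      by (simp add: distrib_left distrib_right scaleC_mult_left scaleC_mult_right scaleC_scaleC)
  qed
  show ?thesis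
    unfolding is_inverse_def using assms comm * by simp
qed

lemma power_times_idempotent:
  fixes t q :: "'b::{ring, monoid_mult}"
  assumes "t * q = q * t" and "q * q = q" and "n \<ge> 1"
  shows "(t * q) ^ n = t ^ n * q"
  using assms(3)
proof (induction n rule: dec_induct)
  case (step n)
  have "(t * q) ^ Suc n = t ^ n * (q * t) * q"
    by (simp only: power_Suc2 step.IH mult.assoc)
  also have "\<dots> = t ^ Suc n * (q * q)"
    by (simp only: assms(1)[symmetric] power_Suc2 mult.assoc)
  finally show ?case
    by (simp add: assms(2))
qed simp

text \<open>
  The polynomial identity behind the Newton iteration \<open>x \<mapsto> 3 x\<^sup>2 - 2 x\<^sup>3\<close> for the equation
  \<open>x\<^sup>2 = x\<close>: the new defect is \<open>4 d\<^sup>3 - 3 d\<^sup>2\<close>, quadratically small in the old defect \<open>d\<close>. Products are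
  spelled out as sums since \<open>x\<close> and \<open>d\<close> live in a ring in which numerals need not be available.
\<close>

lemma newton_defect:
  fixes x d :: "'b::{ring, monoid_mult}"
  assumes "x * x = x + d"
  shows "(x - (x * d + x * d) + d) * (x - (x * d + x * d) + d) - (x - (x * d + x * d) + d)
    = d * d * d + d * d * d + d * d * d + d * d * d - d * d - d * d - d * d"
proof -
  have d: "d = x * x - x" using assms by simp
  have comm: "d * x = x * d" unfolding d by (simp add: algebra_simps)
  have c2: "d * (x * y) = x * (d * y)" for y
    using comm by (metis mult.assoc)
  have x2: "x * (x * y) = x * y + d * y" for y
    using assms by (metis mult.assoc distrib_right)
  show ?thesis
    by (simp add: algebra_simps assms comm c2 x2)
qed

fun newton_idempotent :: "'b::{ring, monoid_mult} \<Rightarrow> nat \<Rightarrow> 'b" where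
  "newton_idempotent x 0 = x"
| "newton_idempotent x (Suc n) = (let y = newton_idempotent x n; d = y * y - y in y - (y * d + y * d) + d)"

lemma newton_idempotent_commutes:
  assumes "b * x = x * b"
  shows "b * newton_idempotent x n = newton_idempotent x n * b"
proof (induction n)
  case (Suc n)
  define y where "y = newton_idempotent x n"
  have y: "b * y = y * b" using Suc by (simp add: y_def)
  have y2: "b * (y * z) = y * (b * z)" for z
    using y by (metis mult.assoc)
  show ?case
    by (simp add: Let_def y_def[symmetric] algebra_simps y y2)
qed (simp add: assms)

text \<open>
  The iterates are controlled together with their defects. The defect is bounded with a factor \<open>1/4\<close> per
  step, far from the quadratic rate, but enough to make the corrections summable; the factor
  \<open>2 - 1 / 2 ^ n\<close> leaves room for the growth of the norm in each step.
\<close>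

lemma newton_idempotent_bounds:
  fixes x :: "'b::complex_banach_algebra" and n :: nat
  assumes "norm (x * x - x) \<le> e" and "e \<le> 1/16"
  defines "y \<equiv> newton_idempotent x n"
  shows "norm (y * y - y) \<le> e / 4 ^ n \<and> 2 * norm y + 1 \<le> (2 - 1 / 2 ^ n) * (2 * norm x + 1)"
  unfolding y_def
proof (induction n)
  case 0
  then show ?case using assms(1) by simp
next
  case (Suc n)
  define y where "y = newton_idempotent x n"
  define d where "d = y * y - y"
  define y' where "y' = newton_idempotent x (Suc n)"
  have IH: "norm d \<le> e / 4 ^ n" "2 * norm y + 1 \<le> (2 - 1 / 2 ^ n) * (2 * norm x + 1)"
    using Suc by (simp_all add: y_def d_def)
  have y': "y' = y - (y * d + y * d) + d"
    by (simp add: y'_def y_def d_def Let_def)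
  have e0: "0 \<le> e" using assms(1) norm_ge_zero order_trans by blast
  have "e / 4 ^ n \<le> e"
    using mult_left_mono[OF one_le_power[of "4::real" n] e0] by (simp add: divide_le_eq)
  then have d16: "norm d \<le> 1/16" using IH(1) assms(2) by linarith
  have d2: "norm (d * d) \<le> norm d * (1/16)"
    by (intro order_trans[OF norm_mult_ineq] mult_left_mono d16) simp
  have d3: "norm (d * d * d) \<le> norm d * (1/16) * (1/16)"
    by (intro order_trans[OF norm_mult_ineq] mult_mono d16 d2) auto
  have "y' * y' - y' = d * d * d + d * d * d + d * d * d + d * d * d - d * d - d * d - d * d"
    unfolding y' by (rule newton_defect) (simp add: d_def)
  also have "\<dots> = 4 *\<^sub>R (d * d * d) - 3 *\<^sub>R (d * d)"
    using scaleR_left_distrib[of 2 2 "d * d * d"] scaleR_left_distrib[of 2 1 "d * d"]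
    by (simp add: scaleR_2)
  finally have "norm (y' * y' - y') \<le> 4 * norm (d * d * d) + 3 * norm (d * d)"
    using norm_triangle_ineq4[of "4 *\<^sub>R (d * d * d)" "3 *\<^sub>R (d * d)"] by simp
  also have "\<dots> \<le> norm d / 4"
    using d2 d3 norm_ge_zero[of d] by linarith
  also have "\<dots> \<le> e / 4 ^ Suc n"
    using IH(1) by (simp add: field_simps)
  finally have defect: "norm (y' * y' - y') \<le> e / 4 ^ Suc n" .
  let ?a = "1 / 2 ^ n :: real"
  have "?a \<le> 1" by simp
  then have a: "0 \<le> ?a" "?a \<le> 1" "?a \<le> 2" by (simp, simp, linarith)
  have aa: "(1 :: real) / 4 ^ n = ?a * ?a"
    by (simp add: power_mult_distrib[symmetric])
  have "norm d \<le> ?a * ?a / 16"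
  proof -
    have "e / 4 ^ n \<le> (1/16) / 4 ^ n" using assms(2) by (intro divide_right_mono) auto
    then show ?thesis using IH(1) aa by simp
  qed
  have "norm (y * d) \<le> norm y * norm d" by (rule norm_mult_ineq)
  moreover have "norm (u - (a + a) + b) \<le> norm u + 2 * norm a + norm b" for u a b :: 'b
    by norm
  ultimately have "norm y' \<le> norm y + 2 * (norm y * norm d) + norm d"
    unfolding y' by (meson add_left_mono add_right_mono mult_left_mono order_trans zero_le_numeral)
  then have "2 * norm y' + 1 \<le> (2 * norm y + 1) * (1 + 2 * norm d)"
    by (simp add: algebra_simps)
  also have "\<dots> \<le> ((2 - ?a) * (2 * norm x + 1)) * (1 + ?a * ?a / 8)"
    using IH(2) \<open>norm d \<le> ?a * ?a / 16\<close> a by (intro mult_mono mult_nonneg_nonneg) auto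
  also have "\<dots> = ((2 - ?a) * (1 + ?a * ?a / 8)) * (2 * norm x + 1)"
    by (simp only: mult_ac)
  also have "\<dots> \<le> (2 - 1 / 2 ^ Suc n) * (2 * norm x + 1)"
  proof (rule mult_right_mono)
    have *: "(2 - v) * (1 + v * v / 8) \<le> 2 - v / 2" if "0 \<le> v" "v \<le> 1" for v :: real
    proof -
      have "v * v \<le> v" "0 \<le> v * v * v"
        using that mult_left_le by auto
      moreover have "(2 - v) * (1 + v * v / 8) = 2 - v + v * v / 4 - v * v * v / 8"
        by (simp add: algebra_simps add_divide_distrib diff_divide_distrib)
      ultimately show ?thesis
        using that by linarith
    qed
    show "(2 - ?a) * (1 + ?a * ?a / 8) \<le> 2 - 1 / 2 ^ Suc n"
      using *[OF a(1,2)] by simp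
  qed simp
  finally show ?case
    using defect by (simp only: y'_def)
qed

text \<open>
  The limit of the Newton iteration. All iterates are polynomials in \<open>x\<close>, which is why the limit
  commutes with everything that commutes with \<open>x\<close>. This replaces the construction of the perturbed
  spectral projection as a contour integral.
\<close>

lemma idempotent_near_approximate_idempotent:
  fixes x :: "'b::complex_banach_algebra"
  assumes "norm (x * x - x) \<le> 1/16"
  shows "\<exists>p. p * p = p \<and> norm (p - x) \<le> 4 * (2 * norm x + 1) * norm (x * x - x) \<and>
    (\<forall>b. b * x = x * b \<longrightarrow> b * p = p * b)"
proof -
  define X where "X = newton_idempotent x"
  define e where "e = norm (x * x - x)"
  define c where "c = 2 * (2 * norm x + 1) * e"
  have b1: "norm (X n * X n - X n) \<le> e * (1/4) ^ n"
    and b2: "2 * norm (X n) + 1 \<le> 2 * (2 * norm x + 1)" for n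
  proof -
    have "(2 - 1 / 2 ^ n) * (2 * norm x + 1) \<le> 2 * (2 * norm x + 1)"
      by (intro mult_right_mono) auto
    then show "norm (X n * X n - X n) \<le> e * (1/4) ^ n" "2 * norm (X n) + 1 \<le> 2 * (2 * norm x + 1)"
      using newton_idempotent_bounds[of x e n] assms by (auto simp: X_def e_def power_divide)
  qed
  have step: "norm (X (Suc n) - X n) \<le> c * (1/4) ^ n" for n
  proof -
    let ?y = "X n"
    let ?d = "?y * ?y - ?y"
    have "X (Suc n) - ?y = ?d - (?y * ?d + ?y * ?d)"
      by (simp add: X_def Let_def)
    moreover have "norm (?y * ?d) \<le> norm ?y * norm ?d"
      by (rule norm_mult_ineq)
    moreover have "norm (b - (a + a)) \<le> norm b + 2 * norm a" for a b :: 'b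
      by norm
    ultimately have "norm (X (Suc n) - ?y) \<le> norm ?d + 2 * (norm ?y * norm ?d)"
      by (smt (verit))
    then have "norm (X (Suc n) - ?y) \<le> (2 * norm ?y + 1) * norm ?d"
      by (simp add: distrib_right)
    also have "\<dots> \<le> (2 * (2 * norm x + 1)) * (e * (1/4) ^ n)"
      by (intro mult_mono b1 b2) auto
    finally show ?thesis by (simp add: c_def mult_ac)
  qed
  have sm: "summable (\<lambda>n. c * (1/4::real) ^ n)"
    by (intro summable_mult summable_geometric) simp
  then have smX: "summable (\<lambda>n. X (Suc n) - X n)"
    by (rule summable_comparison_test') (rule step)
  define p where "p = x + (\<Sum>n. X (Suc n) - X n)"
  have "(\<lambda>n. x + (\<Sum>i<n. X (Suc i) - X i)) \<longlonglongrightarrow> p"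
    unfolding p_def by (intro tendsto_intros summable_LIMSEQ smX)
  moreover have "x + (\<Sum>i<n. X (Suc i) - X i) = X n" for n
    unfolding sum_lessThan_telescope by (simp add: X_def)
  ultimately have lim: "X \<longlonglongrightarrow> p" by simp
  have "(\<lambda>n. e * (1/4) ^ n) \<longlonglongrightarrow> 0"
    using tendsto_mult_left[OF LIMSEQ_realpow_zero[of "1/4"], of e] by simp
  moreover have "\<forall>\<^sub>F n in sequentially. norm (X n * X n - X n) \<le> e * (1/4) ^ n"
    by (rule always_eventually) (use b1 in blast)
  ultimately have "(\<lambda>n. X n * X n - X n) \<longlonglongrightarrow> 0"
    by (rule Lim_null_comparison[rotated])
  moreover have "(\<lambda>n. X n * X n - X n) \<longlonglongrightarrow> p * p - p"
    by (intro tendsto_intros lim)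
  ultimately have "p * p - p = 0"
    using LIMSEQ_unique by blast
  then have "p * p = p" by simp
  moreover have "norm (p - x) \<le> 4 * (2 * norm x + 1) * e"
  proof -
    have "norm (p - x) \<le> (\<Sum>n. c * (1/4) ^ n)"
      unfolding p_def using norm_suminf_le[OF step sm] by simp
    also have "\<dots> = c * (4/3)"
      by (subst suminf_mult) (simp_all add: suminf_geometric summable_geometric)
    also have "\<dots> \<le> c * 2"
      by (intro mult_left_mono) (simp_all add: c_def e_def)
    finally show ?thesis
      unfolding c_def by linarith
  qed
  moreover have "b * p = p * b" if "b * x = x * b" for b
  proof (rule LIMSEQ_unique)
    show "(\<lambda>n. b * X n) \<longlonglongrightarrow> b * p"
      by (rule tendsto_mult_left[OF lim])
    show "(\<lambda>n. b * X n) \<longlonglongrightarrow> p * b"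
      using tendsto_mult_right[OF lim, of b] newton_idempotent_commutes[OF that] by (simp add: X_def)
  qed
  ultimately show ?thesis
    unfolding e_def[symmetric] by blast
qed

lemma idempotent_near_idempotent:
  fixes p :: "'b::complex_banach_algebra"
  assumes "p * p = p" and "0 < e"
  shows "\<exists>h>0. \<forall>u. norm (u - p) < h \<longrightarrow>
    (\<exists>p'. p' * p' = p' \<and> norm (p' - p) < e \<and> norm (u - p') < e \<and> (\<forall>b. b * u = u * b \<longrightarrow> b * p' = p' * b))"
proof -
  have "((\<lambda>u. norm (u * u - u)) \<longlongrightarrow> norm (p * p - p)) (nhds p)"
    by (intro tendsto_intros tendsto_ident_at filterlim_ident)
  then have ev1: "\<forall>\<^sub>F u in nhds p. norm (u * u - u) < 1/16"
    by (rule order_tendstoD(2)) (simp add: assms(1))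
  have "((\<lambda>u. 4 * (2 * norm u + 1) * norm (u * u - u) + norm (u - p))
      \<longlongrightarrow> 4 * (2 * norm p + 1) * norm (p * p - p) + norm (p - p)) (nhds p)"
    by (intro tendsto_intros filterlim_ident)
  then have ev2: "\<forall>\<^sub>F u in nhds p. 4 * (2 * norm u + 1) * norm (u * u - u) + norm (u - p) < e"
    by (rule order_tendstoD(2)) (simp add: assms)
  from eventually_conj[OF ev1 ev2] obtain h where "h > 0" and h: "\<And>u. norm (u - p) < h \<Longrightarrow>
      norm (u * u - u) < 1/16 \<and> 4 * (2 * norm u + 1) * norm (u * u - u) + norm (u - p) < e"
    unfolding eventually_nhds_metric dist_norm by blast
  show ?thesis
  proof (intro exI[of _ h] conjI allI impI)
    fix u assume "norm (u - p) < h"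
    from h[OF this] have u1: "norm (u * u - u) \<le> 1/16"
      and u2: "4 * (2 * norm u + 1) * norm (u * u - u) + norm (u - p) < e" by auto
    from idempotent_near_approximate_idempotent[OF u1] obtain p' where p': "p' * p' = p'"
      "norm (p' - u) \<le> 4 * (2 * norm u + 1) * norm (u * u - u)"
      "\<forall>b. b * u = u * b \<longrightarrow> b * p' = p' * b"
      by blast
    have "norm (p' - p) \<le> norm (p' - u) + norm (u - p)"
      using norm_triangle_ineq[of "p' - u" "u - p"] by simp
    moreover have "norm (u - p') = norm (p' - u)"
      by (rule norm_minus_commute)
    moreover have "0 \<le> norm (u - p)" by simp
    ultimately have "norm (p' - p) < e" "norm (u - p') < e"
      using p'(2) u2 by linarith+
    then show "\<exists>p'. p' * p' = p' \<and> norm (p' - p) < e \<and> norm (u - p') < e \<and>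
        (\<forall>b. b * u = u * b \<longrightarrow> b * p' = p' * b)"
      using p' by blast
  qed fact
qed

section \<open>Riesz projections\<close>

text \<open>
  The Riesz projection, with the factor \<open>\<zeta> - \<mu>\<close> of the line element \<open>d\<zeta>\<close> moved into the integrand of
  a circle mean.
\<close>

definition riesz :: "'b::complex_banach_algebra \<Rightarrow> complex \<Rightarrow> real \<Rightarrow> 'b" where
  "riesz t \<mu> r = circle_mean \<mu> r (\<lambda>\<zeta>. (\<zeta> - \<mu>) *\<^sub>C rsv t \<zeta>)"

lemma circle_mean_commutes:
  fixes b :: "'b::complex_banach_algebra"
  assumes "0 \<le> r" and "continuous_on (sphere c r) g" and "\<And>\<zeta>. cmod (\<zeta> - c) = r \<Longrightarrow> g \<zeta> * b = b * g \<zeta>"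
  shows "circle_mean c r g * b = b * circle_mean c r g"
proof -
  have "circle_mean c r g * b = circle_mean c r (\<lambda>\<zeta>. g \<zeta> * b)"
    using circle_mean_bounded_linear[OF bounded_linear_mult_left assms(1,2)] by simp
  also have "\<dots> = circle_mean c r (\<lambda>\<zeta>. b * g \<zeta>)"
    by (intro circle_mean_cong assms)
  also have "\<dots> = b * circle_mean c r g"
    using circle_mean_bounded_linear[OF bounded_linear_mult_right assms(1,2)] by simp
  finally show ?thesis .
qed

lemma sphere_outside_spec:
  assumes "0 < r" and "spec t \<inter> cball \<mu> r \<subseteq> {\<mu>}"
  shows "sphere \<mu> r \<subseteq> - spec t"
  using assms by force

lemma riesz_commutes:
  fixes t b :: "'b::complex_banach_algebra"
  assumes "0 < r" and "spec t \<inter> cball \<mu> r \<subseteq> {\<mu>}" and "t * b = b * t"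
  shows "riesz t \<mu> r * b = b * riesz t \<mu> r"
  unfolding riesz_def
proof (rule circle_mean_commutes)
  note sub = sphere_outside_spec[OF assms(1,2)]
  show "continuous_on (sphere \<mu> r) (\<lambda>\<zeta>. (\<zeta> - \<mu>) *\<^sub>C rsv t \<zeta>)"
    by (intro continuous_intros continuous_on_subset[OF continuous_on_rsv sub])
  fix \<zeta> assume "cmod (\<zeta> - \<mu>) = r"
  then have "\<zeta> \<notin> spec t"
    using sub by (auto simp: dist_norm norm_minus_commute)
  then show "(\<zeta> - \<mu>) *\<^sub>C rsv t \<zeta> * b = b * (\<zeta> - \<mu>) *\<^sub>C rsv t \<zeta>"
    using assms(3) by (simp add: scaleC_mult_left scaleC_mult_right rsv_commutes)
qed (use assms(1) in simp)

text \<open>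
  The mean \<open>s\<close> of the resolvent over the circle, which is the constant coefficient of its Laurent
  expansion at \<open>\<mu>\<close>, inverts \<open>\<mu> - t\<close> on the complement of the Riesz projection: average
  \<open>rsv t \<zeta> * (\<mu> - t) = 1 - (\<zeta> - \<mu>) *\<^sub>C rsv t \<zeta>\<close>.
\<close>

lemma reduced_resolvent:
  fixes t :: "'b::complex_banach_algebra"
  assumes "0 < r" and "spec t \<inter> cball \<mu> r \<subseteq> {\<mu>}"
  shows "\<exists>s. s * (\<mu> *\<^sub>C 1 - t) = 1 - riesz t \<mu> r \<and> (\<forall>b. t * b = b * t \<longrightarrow> s * b = b * s)"
proof (intro exI conjI allI impI)
  note sub = sphere_outside_spec[OF assms(1,2)]
  have notin: "\<zeta> \<notin> spec t" if "cmod (\<zeta> - \<mu>) = r" for \<zeta>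
    using sub that by (auto simp: dist_norm norm_minus_commute)
  have cont: "continuous_on (sphere \<mu> r) (rsv t)"
    by (rule continuous_on_subset[OF continuous_on_rsv sub])
  have r: "0 \<le> r" using assms(1) by simp
  show "circle_mean \<mu> r (rsv t) * b = b * circle_mean \<mu> r (rsv t)" if "t * b = b * t" for b
    using r cont by (rule circle_mean_commutes) (intro rsv_commutes notin that)
  have "circle_mean \<mu> r (rsv t) * (\<mu> *\<^sub>C 1 - t) = circle_mean \<mu> r (\<lambda>\<zeta>. rsv t \<zeta> * (\<mu> *\<^sub>C 1 - t))"
    using circle_mean_bounded_linear[OF bounded_linear_mult_left r cont] by simp
  also have "\<dots> = circle_mean \<mu> r (\<lambda>\<zeta>. 1 - (\<zeta> - \<mu>) *\<^sub>C rsv t \<zeta>)"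
    by (rule circle_mean_cong[OF r])
      (simp add: notin rsv_mult right_diff_distrib scaleC_mult_right scaleC_simps)
  also have "\<dots> = 1 - riesz t \<mu> r"
    unfolding riesz_def by (subst circle_mean_diff[OF r])
      (auto intro!: continuous_intros cont simp: circle_mean_const)
  finally show "circle_mean \<mu> r (rsv t) * (\<mu> *\<^sub>C 1 - t) = 1 - riesz t \<mu> r" .
qed

text \<open>
  Off \<open>\<mu>\<close> the resolvent of \<open>t\<close> itself gives an inverse on the part \<open>1 - p\<close>; at \<open>\<mu>\<close> the reduced
  resolvent does. On the part \<open>p\<close>, \<open>t\<close> has been replaced by \<open>0\<close>, which accounts for the point \<open>0\<close>.
\<close>

lemma spec_complement:
  fixes t p :: "'b::complex_banach_algebra"
  assumes "0 < r" and "spec t \<inter> cball \<mu> r \<subseteq> {\<mu>}" and p: "p = riesz t \<mu> r"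
    and "p * p = p"
  shows "spec (t * (1 - p)) \<subseteq> insert 0 (spec t - {\<mu>})"
proof
  fix \<zeta> assume spec: "\<zeta> \<in> spec (t * (1 - p))"
  have comm: "t * p = p * t"
    unfolding p using riesz_commutes[OF assms(1,2), of t] by simp
  have inv: False if "\<zeta> \<noteq> 0" and "y * p = p * y" and "(\<zeta> *\<^sub>C 1 - t) * y * (1 - p) = 1 - p"
    and "y * (\<zeta> *\<^sub>C 1 - t) * (1 - p) = 1 - p" for y
  proof -
    have "is_inverse ((\<zeta> *\<^sub>C 1 - t) * (1 - p) + \<zeta> *\<^sub>C p) (y * (1 - p) + inverse \<zeta> *\<^sub>C p)"
      by (rule is_inverse_compress)
        (use that assms(4) comm in \<open>simp_all add: algebra_simps scaleC_mult_left scaleC_mult_right\<close>)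
    moreover have "(\<zeta> *\<^sub>C 1 - t) * (1 - p) + \<zeta> *\<^sub>C p = \<zeta> *\<^sub>C 1 - t * (1 - p)"
      by (simp add: algebra_simps scaleC_mult_left scaleC_mult_right scaleC_simps)
    ultimately show False
      using spec not_specI by metis
  qed
  show "\<zeta> \<in> insert 0 (spec t - {\<mu>})"
  proof (rule ccontr)
    assume "\<not> ?thesis"
    then consider "\<zeta> \<noteq> 0" "\<zeta> \<notin> spec t" | "\<zeta> \<noteq> 0" "\<zeta> = \<mu>" by auto
    then show False
    proof cases
      case 1
      then show False
        using inv[of "rsv t \<zeta>"] is_inverse_rsv[OF 1(2)] rsv_commutes[OF 1(2) comm]
        by (simp add: is_inverse_def)
    next
      case 2
      obtain s where s: "s * (\<mu> *\<^sub>C 1 - t) = 1 - p" and s_comm: "\<And>b. t * b = b * t \<Longrightarrow> s * b = b * s"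
        using reduced_resolvent[OF assms(1,2)] unfolding p by blast
      have "(\<mu> *\<^sub>C 1 - t) * s = 1 - p"
        using s s_comm[of "\<mu> *\<^sub>C 1 - t"]
        by (simp add: algebra_simps scaleC_mult_left scaleC_mult_right)
      moreover have "(1 - p) * (1 - p) = 1 - p"
        using assms(4) by (simp add: algebra_simps)
      ultimately show False
        using inv[of s] 2 s s_comm[OF comm] by simp
    qed
  qed
qed

section \<open>Dominant idempotents\<close>

text \<open>
  The algebraic content of a simple top eigenvalue \<open>\<mu>\<close> with eigenprojection \<open>p\<close>, short of
  the rank of \<open>p\<close>.
\<close>

definition dominant :: "'b::complex_banach_algebra \<Rightarrow> complex \<Rightarrow> 'b \<Rightarrow> bool" where
  "dominant t \<mu> p \<longleftrightarrow> p * p = p \<and> t * p = \<mu> *\<^sub>C p \<and> p * t = \<mu> *\<^sub>C p \<and>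
     geometric_below (t * (1 - p)) (cmod \<mu>)"

lemma dominant_spec:
  fixes t p :: "'b::complex_banach_algebra"
  assumes "dominant t \<mu> p"
  shows "\<exists>\<rho>. 0 \<le> \<rho> \<and> \<rho> < cmod \<mu> \<and> spec t - {\<mu>} \<subseteq> cball 0 \<rho> \<and> spec (t * (1 - p)) \<subseteq> cball 0 \<rho>"
proof -
  have p: "p * p = p" "t * p = \<mu> *\<^sub>C p" "p * t = \<mu> *\<^sub>C p"
    and "geometric_below (t * (1 - p)) (cmod \<mu>)"
    using assms by (auto simp: dominant_def)
  then obtain \<rho> where \<rho>: "0 \<le> \<rho>" "\<rho> < cmod \<mu>" "spec (t * (1 - p)) \<subseteq> cball 0 \<rho>"
    using geometric_below_spec by blast
  let ?a = "t * (1 - p)"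
  have a: "?a = t - \<mu> *\<^sub>C p" "?a * p = 0" "p * ?a = 0"
    using p by (simp_all add: algebra_simps scaleC_mult_left scaleC_mult_right)
  have "\<zeta> \<notin> spec t" if "\<zeta> \<notin> spec ?a" "\<zeta> \<noteq> \<mu>" for \<zeta>
  proof (rule not_specI)
    have "is_inverse ((\<zeta> *\<^sub>C 1 - ?a) * (1 - p) + (\<zeta> - \<mu>) *\<^sub>C p)
        (rsv ?a \<zeta> * (1 - p) + inverse (\<zeta> - \<mu>) *\<^sub>C p)"
      using is_inverse_rsv[OF that(1)] p(1) that(2) rsv_commutes[OF that(1), of p] a
      by (intro is_inverse_compress)
        (simp_all add: is_inverse_def right_diff_distrib left_diff_distrib scaleC_mult_left scaleC_mult_right)
    moreover have "(\<zeta> *\<^sub>C 1 - ?a) * (1 - p) + (\<zeta> - \<mu>) *\<^sub>C p = \<zeta> *\<^sub>C 1 - t"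
      using a p by (simp add: algebra_simps scaleC_mult_left scaleC_mult_right scaleC_simps)
    ultimately show "is_inverse (\<zeta> *\<^sub>C 1 - t) (rsv ?a \<zeta> * (1 - p) + inverse (\<zeta> - \<mu>) *\<^sub>C p)"
      by simp
  qed
  then show ?thesis
    using \<rho> by (intro exI[of _ \<rho>]) auto
qed

text \<open>
  The resolvent of \<open>t\<close> is \<open>p / (\<zeta> - \<mu>)\<close> plus a part on \<open>1 - p\<close> that has to be extended
  holomorphically to the whole disc. The disc is only known to contain no other spectral point of \<open>t\<close>,
  and it may contain \<open>0\<close>, which lies in the spectrum of \<open>t * (1 - p)\<close> as soon as \<open>p \<noteq> 0\<close>.
  So \<open>\<mu>\<close> is moved to a point \<open>c\<close> outside the disc instead: \<open>a\<close> agrees with \<open>t\<close> on the part \<open>1 - p\<close> and is \<open>c\<close> on the part \<open>p\<close>, and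
  its resolvent is the extension. The mean value property then shows that this part does not
  contribute.
\<close>

lemma dominant_riesz:
  fixes t p :: "'b::complex_banach_algebra"
  assumes "dominant t \<mu> p" and "0 < r" and "spec t \<inter> cball \<mu> r \<subseteq> {\<mu>}"
  shows "riesz t \<mu> r = p"
proof -
  have p: "p * p = p" "t * p = \<mu> *\<^sub>C p" "p * t = \<mu> *\<^sub>C p"
    using assms(1) by (auto simp: dominant_def)
  have q: "(1 - p) * (1 - p) = 1 - p" "p * (1 - p) = 0"
    using p(1) by (simp_all add: algebra_simps)
  define c where "c = \<mu> + of_real (r + 1)"
  define a where "a = t * (1 - p) + c *\<^sub>C p"
  have key: "is_inverse (\<zeta> *\<^sub>C 1 - a) (y * (1 - p) + inverse (\<zeta> - c) *\<^sub>C p)"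
    if "cmod (\<zeta> - \<mu>) \<le> r" and "y * p = p * y" and "(\<zeta> *\<^sub>C 1 - t) * y * (1 - p) = 1 - p"
      and "y * (\<zeta> *\<^sub>C 1 - t) * (1 - p) = 1 - p" for \<zeta> y
  proof -
    have "cmod (c - \<mu>) = r + 1"
      unfolding c_def using assms(2) by (simp flip: of_real_add add: norm_of_real del: of_real_add)
    then have "\<zeta> - c \<noteq> 0"
      using that(1) by auto
    have "is_inverse ((\<zeta> *\<^sub>C 1 - t) * (1 - p) + (\<zeta> - c) *\<^sub>C p) (y * (1 - p) + inverse (\<zeta> - c) *\<^sub>C p)"
      by (rule is_inverse_compress)
        (use that p \<open>\<zeta> - c \<noteq> 0\<close> in \<open>simp_all add: left_diff_distrib right_diff_distrib scaleC_mult_left scaleC_mult_right\<close>)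
    moreover have "(\<zeta> *\<^sub>C 1 - t) * (1 - p) + (\<zeta> - c) *\<^sub>C p = \<zeta> *\<^sub>C 1 - a"
      by (simp add: a_def algebra_simps scaleC_mult_left scaleC_mult_right scaleC_simps)
    ultimately show ?thesis by simp
  qed
  have rsv_a: "is_inverse (\<zeta> *\<^sub>C 1 - a) (rsv t \<zeta> * (1 - p) + inverse (\<zeta> - c) *\<^sub>C p)"
    if "cmod (\<zeta> - \<mu>) \<le> r" "\<zeta> \<notin> spec t" for \<zeta>
    using is_inverse_rsv[OF that(2)] rsv_commutes[OF that(2), of p] p
    by (intro key that) (simp_all add: is_inverse_def)
  have disc: "cball \<mu> r \<subseteq> - spec a"
  proof
    fix \<zeta> assume "\<zeta> \<in> cball \<mu> r"
    then have \<zeta>: "cmod (\<zeta> - \<mu>) \<le> r" "\<zeta> \<noteq> \<mu> \<Longrightarrow> \<zeta> \<notin> spec t"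
      using assms(3) by (auto simp: dist_norm norm_minus_commute)
    show "\<zeta> \<in> - spec a"
    proof (cases "\<zeta> = \<mu>")
      case False
      then show ?thesis
        using rsv_a[OF \<zeta>(1)] \<zeta>(2) not_specI by blast
    next
      case True
      obtain \<rho> where "\<rho> < cmod \<mu>" "spec (t * (1 - p)) \<subseteq> cball 0 \<rho>"
        using dominant_spec[OF assms(1)] by auto
      then have notin: "\<mu> \<notin> spec (t * (1 - p))" by auto
      define w where "w = rsv (t * (1 - p)) \<mu>"
      have w: "(\<mu> *\<^sub>C 1 - t * (1 - p)) * w = 1" "w * (\<mu> *\<^sub>C 1 - t * (1 - p)) = 1"
        using is_inverse_rsv[OF notin] by (simp_all add: w_def is_inverse_def)
      have wp: "w * p = p * w"
        unfolding w_def using notin p by (intro rsv_commutes)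
          (simp_all add: algebra_simps scaleC_mult_left scaleC_mult_right)
      then have wq: "w * (1 - p) = (1 - p) * w"
        by (simp add: algebra_simps)
      have red: "(\<mu> *\<^sub>C 1 - t * (1 - p)) * (1 - p) = (\<mu> *\<^sub>C 1 - t) * (1 - p)"
        using q(1) by (simp add: left_diff_distrib mult.assoc)
      have "(\<mu> *\<^sub>C 1 - t) * w * (1 - p) = (\<mu> *\<^sub>C 1 - t * (1 - p)) * w * (1 - p)"
        using red by (simp add: mult.assoc wq) (simp flip: mult.assoc)
      moreover have "w * (\<mu> *\<^sub>C 1 - t) * (1 - p) = w * (\<mu> *\<^sub>C 1 - t * (1 - p)) * (1 - p)"
        using red by (simp add: mult.assoc)
      ultimately have "is_inverse (\<zeta> *\<^sub>C 1 - a) (w * (1 - p) + inverse (\<zeta> - c) *\<^sub>C p)"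
        using True wp w by (intro key \<zeta>) auto
      then show ?thesis
        using not_specI by blast
    qed
  qed
  have "riesz t \<mu> r = circle_mean \<mu> r (\<lambda>\<zeta>. p + ((\<zeta> - \<mu>) ^ 1 *\<^sub>C rsv a \<zeta>) * (1 - p))"
    unfolding riesz_def
  proof (rule circle_mean_cong)
    fix \<zeta> assume \<zeta>: "cmod (\<zeta> - \<mu>) = r"
    then have notin: "\<zeta> \<notin> spec t"
      using sphere_outside_spec[OF assms(2,3)] by (auto simp: dist_norm norm_minus_commute)
    have "rsv a \<zeta> = rsv t \<zeta> * (1 - p) + inverse (\<zeta> - c) *\<^sub>C p"
      using rsv_a[OF _ notin] \<zeta> by (intro rsv_eqI) simp
    then have eq: "rsv a \<zeta> * (1 - p) = rsv t \<zeta> * (1 - p)"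
      using q by (simp add: distrib_right scaleC_mult_left mult.assoc)
    have "rsv t \<zeta> * (t * p) = (rsv t \<zeta> * t) * p"
      by (simp add: mult.assoc)
    then have on_p: "(\<zeta> - \<mu>) *\<^sub>C (rsv t \<zeta> * p) = p"
      by (simp add: p rsv_mult[OF notin] scaleC_mult_right scaleC_mult_left left_diff_distrib scaleC_simps)
    have "(\<zeta> - \<mu>) *\<^sub>C rsv t \<zeta> = (\<zeta> - \<mu>) *\<^sub>C (rsv t \<zeta> * p + rsv t \<zeta> * (1 - p))"
      by (simp add: right_diff_distrib)
    also have "\<dots> = p + ((\<zeta> - \<mu>) ^ 1 *\<^sub>C rsv a \<zeta>) * (1 - p)"
      by (simp only: scaleC.add_right on_p scaleC_mult_left eq power_one_right)
    finally show "(\<zeta> - \<mu>) *\<^sub>C rsv t \<zeta> = p + ((\<zeta> - \<mu>) ^ 1 *\<^sub>C rsv a \<zeta>) * (1 - p)" .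
  qed (use assms(2) in simp)
  also have "\<dots> = p + circle_mean \<mu> r (\<lambda>\<zeta>. (\<zeta> - \<mu>) ^ 1 *\<^sub>C rsv a \<zeta>) * (1 - p)"
  proof -
    have "continuous_on (sphere \<mu> r) (\<lambda>\<zeta>. (\<zeta> - \<mu>) ^ 1 *\<^sub>C rsv a \<zeta>)"
      using disc by (intro continuous_intros continuous_on_subset[OF continuous_on_rsv]) auto
    then show ?thesis
      using assms(2) circle_mean_bounded_linear[OF bounded_linear_mult_left[of "1 - p"]]
      by (subst circle_mean_add) (auto intro!: continuous_intros simp: circle_mean_const)
  qed
  also have "circle_mean \<mu> r (\<lambda>\<zeta>. (\<zeta> - \<mu>) ^ 1 *\<^sub>C rsv a \<zeta>) = circle_mean \<mu> 0 (\<lambda>\<zeta>. (\<zeta> - \<mu>) ^ 1 *\<^sub>C rsv a \<zeta>)"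
    using assms(2) disc by (intro power_rsv_mean_indep[symmetric]) auto
  finally show ?thesis
    by (simp add: circle_mean_center)
qed

text \<open>
  For large \<open>N\<close> the power \<open>(t / \<mu>) ^ N\<close> is close to \<open>p\<close>, because the complementary part decays; for
  this fixed \<open>N\<close> the power \<open>u\<close> of a nearby \<open>t'\<close> is also close to \<open>p\<close>. The idempotent \<open>p'\<close> near \<open>u\<close>
  commutes with \<open>t'\<close>, and \<open>u\<close> is almost \<open>0\<close> on the part \<open>1 - p'\<close> and almost \<open>1\<close> on the part \<open>p'\<close>,
  which separates the two parts of \<open>t'\<close>.
\<close>

lemma dominant_perturbation:
  fixes t p :: "'b::complex_banach_algebra"
  assumes "dominant t \<mu> p" and "0 < e"
  shows "\<exists>h>0. \<forall>t'. norm (t' - t) < h \<longrightarrow> (\<exists>p' N. N \<ge> 1 \<and> p' * p' = p' \<and> t' * p' = p' * t' \<and>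
    norm (p' - p) < e \<and> norm ((t' * (1 - p')) ^ N) \<le> cmod \<mu> ^ N / 4 \<and>
    norm (t' ^ N * p' - \<mu> ^ N *\<^sub>C p') \<le> cmod \<mu> ^ N / 4 * norm p')"
proof -
  have p: "p * p = p" "t * p = \<mu> *\<^sub>C p" "p * t = \<mu> *\<^sub>C p"
    and geo: "geometric_below (t * (1 - p)) (cmod \<mu>)"
    using assms(1) by (auto simp: dominant_def)
  then have \<mu>: "cmod \<mu> > 0"
    by (auto simp: geometric_below_def)
  \<comment> \<open>\<open>K\<close> bounds \<open>norm (1 - p')\<close>, and \<open>e' * K \<le> 1/4\<close>.\<close>
  define K where "K = norm (1::'b) + norm p + 1"
  define e' where "e' = Min {e, 1, 1 / (4 * K), 1/4}"
  have K: "0 < K" "1 \<le> K" by (simp_all add: K_def add_nonneg_pos)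
  have "0 < e'" using K assms(2) by (simp add: e'_def)
  moreover have "e' \<le> e" "e' \<le> 1" "e' \<le> 1 / (4 * K)" "e' \<le> 1/4"
    unfolding e'_def by (rule Min_le; simp)+
  ultimately have e': "0 < e'" "e' \<le> e" "e' \<le> 1" "e' \<le> 1 / (4 * K)" "e' \<le> 1/4" .
  obtain h where h: "h > 0" and near: "\<And>u. norm (u - p) < h \<Longrightarrow>
      \<exists>p'. p' * p' = p' \<and> norm (p' - p) < e' \<and> norm (u - p') < e' \<and> (\<forall>b. b * u = u * b \<longrightarrow> b * p' = p' * b)"
    using idempotent_near_idempotent[OF p(1) e'(1)] by blast
  obtain N where N: "N \<ge> 1" and small: "norm ((t * (1 - p)) ^ N) < h * cmod \<mu> ^ N"
    using eventually_conj[OF geometric_below_eventually[OF geo h] eventually_ge_at_top[of 1]]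
    by (auto dest: eventually_happens)
  let ?u = "\<lambda>t'. inverse (\<mu> ^ N) *\<^sub>C t' ^ N"
  have tN: "t ^ N = \<mu> ^ N *\<^sub>C p + (t * (1 - p)) ^ N"
  proof -
    have "t ^ k * p = \<mu> ^ k *\<^sub>C p" for k
      by (induction k) (simp_all add: p mult.assoc scaleC_mult_right scaleC_scaleC mult.commute)
    moreover have "(t * (1 - p)) ^ N = t ^ N * (1 - p)"
      using p N by (intro power_times_idempotent) (simp_all add: algebra_simps)
    ultimately show ?thesis
      by (simp add: right_diff_distrib)
  qed
  have "norm (?u t - p) < h"
  proof -
    have "?u t - p = inverse (\<mu> ^ N) *\<^sub>C (t * (1 - p)) ^ N"
      using \<mu> by (simp add: tN scaleC_simps)
    then have "norm (?u t - p) = norm ((t * (1 - p)) ^ N) / cmod \<mu> ^ N"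
      by (simp add: norm_scaleC norm_inverse norm_power divide_inverse mult.commute power_inverse)
    then show ?thesis
      using small \<mu> by (simp add: divide_less_eq)
  qed
  moreover have "((\<lambda>t'. norm (?u t' - p)) \<longlongrightarrow> norm (?u t - p)) (nhds t)"
    by (intro tendsto_intros scaleC.tendsto filterlim_ident)
  ultimately have "\<forall>\<^sub>F t' in nhds t. norm (?u t' - p) < h"
    by (rule order_tendstoD(2)[rotated])
  then obtain g where g: "g > 0" "\<And>t'. norm (t' - t) < g \<Longrightarrow> norm (?u t' - p) < h"
    unfolding eventually_nhds_metric dist_norm by blast
  show ?thesis
  proof (intro exI[of _ g] conjI allI impI)
    fix t' assume "norm (t' - t) < g"
    from near[OF g(2)[OF this]] obtain p' where p': "p' * p' = p'" "norm (p' - p) < e'"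
      "norm (?u t' - p') < e'" and comm: "\<And>b. b * ?u t' = ?u t' * b \<Longrightarrow> b * p' = p' * b"
      by blast
    have t'p': "t' * p' = p' * t'"
      by (rule comm) (simp add: scaleC_mult_left scaleC_mult_right power_commutes)
    have u: "t' ^ N = \<mu> ^ N *\<^sub>C ?u t'"
      using \<mu> by (simp add: scaleC_scaleC)
    have "norm (?u t' * (1 - p')) \<le> 1/4"
    proof -
      have "?u t' * (1 - p') = (?u t' - p') * (1 - p')"
        using p'(1) by (simp add: algebra_simps)
      then have "norm (?u t' * (1 - p')) \<le> norm (?u t' - p') * norm (1 - p')"
        by (simp add: norm_mult_ineq)
      moreover have "norm (1 - p') \<le> norm (1::'b) + norm p + norm (p' - p)"
        by norm
      then have "norm (1 - p') \<le> K"
        unfolding K_def using p'(2) e'(3) by linarith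
      ultimately have "norm (?u t' * (1 - p')) \<le> e' * K"
        using p'(3) by (meson less_imp_le mult_mono norm_ge_zero order_trans e'(1))
      also have "\<dots> \<le> 1/4"
        using e'(4) K by (simp add: field_simps)
      finally show ?thesis .
    qed
    moreover have "(t' * (1 - p')) ^ N = \<mu> ^ N *\<^sub>C (?u t' * (1 - p'))"
    proof -
      have "(t' * (1 - p')) ^ N = t' ^ N * (1 - p')"
        using t'p' p'(1) N by (intro power_times_idempotent) (simp_all add: algebra_simps)
      then show ?thesis
        by (metis u scaleC_mult_left)
    qed
    ultimately have c1: "norm ((t' * (1 - p')) ^ N) \<le> cmod \<mu> ^ N / 4"
      using mult_left_mono[of "norm (?u t' * (1 - p'))" "1/4" "cmod \<mu> ^ N"]
      by (simp add: norm_scaleC norm_power)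
    have "t' ^ N * p' - \<mu> ^ N *\<^sub>C p' = \<mu> ^ N *\<^sub>C ((?u t' - p') * p')"
      by (subst u) (simp add: left_diff_distrib p'(1) scaleC_mult_left scaleC.diff_right)
    then have "norm (t' ^ N * p' - \<mu> ^ N *\<^sub>C p') = cmod \<mu> ^ N * norm ((?u t' - p') * p')"
      by (simp add: norm_scaleC norm_power)
    also have "\<dots> \<le> cmod \<mu> ^ N * (1/4 * norm p')"
      using p'(3) e'(5) by (intro mult_left_mono order_trans[OF norm_mult_ineq] mult_right_mono) auto
    finally show "\<exists>p' N. N \<ge> 1 \<and> p' * p' = p' \<and> t' * p' = p' * t' \<and>
        norm (p' - p) < e \<and> norm ((t' * (1 - p')) ^ N) \<le> cmod \<mu> ^ N / 4 \<and>
        norm (t' ^ N * p' - \<mu> ^ N *\<^sub>C p') \<le> cmod \<mu> ^ N / 4 * norm p'"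
      using N p' t'p' c1 e'(2) by (intro exI[of _ p'] exI[of _ N]) auto
  qed fact
qed

section \<open>The algebra of complex-linear operators\<close>

text \<open>
  The real-linear operators do not form a complex algebra, since left multiplication by them need not
  commute with complex scalars; hence the subtype.
\<close>

typedef (overloaded) ('a::complex_banach) clop = "{T :: 'a \<Rightarrow>\<^sub>L 'a. complex_linear T}"
  morphisms op_of Clop
  by (rule exI[of _ 0]) (simp add: complex_linear_def)

setup_lifting type_definition_clop

lemma complex_linear_scaleC: "complex_linear T \<Longrightarrow> complex_linear (c *\<^sub>C T)"
  by (simp add: complex_linear_def scaleC_blinfun.rep_eq scaleC_scaleC mult.commute)

instantiation clop :: (complex_banach) "{complex_normed_vector, real_normed_algebra, monoid_mult}"
begin

lift_definition zero_clop :: "'a clop" is 0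
  by (simp add: complex_linear_def)
lift_definition one_clop :: "'a clop" is id_blinfun
  by (simp add: complex_linear_def)
lift_definition plus_clop :: "'a clop \<Rightarrow> 'a clop \<Rightarrow> 'a clop" is "(+)"
  by (simp add: complex_linear_def blinfun.add_left scaleC_add_right)
lift_definition minus_clop :: "'a clop \<Rightarrow> 'a clop \<Rightarrow> 'a clop" is "(-)"
  by (simp add: complex_linear_def blinfun.diff_left scaleC.diff_right)
lift_definition uminus_clop :: "'a clop \<Rightarrow> 'a clop" is uminus
  by (simp add: complex_linear_def blinfun.minus_left scaleC.minus_right)
lift_definition times_clop :: "'a clop \<Rightarrow> 'a clop \<Rightarrow> 'a clop" is "(o\<^sub>L)"
  by (simp add: complex_linear_def)
lift_definition scaleR_clop :: "real \<Rightarrow> 'a clop \<Rightarrow> 'a clop" is scaleR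
  by (simp add: complex_linear_scaleC flip: scaleC_of_real)
lift_definition scaleC_clop :: "complex \<Rightarrow> 'a clop \<Rightarrow> 'a clop" is scaleC
  by (rule complex_linear_scaleC)
lift_definition norm_clop :: "'a clop \<Rightarrow> real" is norm .

definition dist_clop :: "'a clop \<Rightarrow> 'a clop \<Rightarrow> real" where
  "dist_clop x y = norm (x - y)"
definition sgn_clop :: "'a clop \<Rightarrow> 'a clop" where
  "sgn_clop x = inverse (norm x) *\<^sub>R x"
definition uniformity_clop :: "('a clop \<times> 'a clop) filter" where
  "uniformity_clop = (INF e\<in>{0<..}. principal {(x, y). dist x y < e})"
definition open_clop :: "'a clop set \<Rightarrow> bool" where
  "open_clop U \<longleftrightarrow> (\<forall>x\<in>U. \<forall>\<^sub>F (x', y) in uniformity. x' = x \<longrightarrow> y \<in> U)"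

instance
proof
  fix x y z :: "'a clop" and r s :: real and c d :: complex and U :: "'a clop set"
  show "x + y + z = x + (y + z)" "x + y = y + x" "0 + x = x" "- x + x = 0" "x - y = x + - y"
    by (transfer, simp)+
  show "x * y * z = x * (y * z)" "1 * x = x" "x * 1 = x"
    by (transfer, auto intro: blinfun_eqI)+
  show "(x + y) * z = x * z + y * z" "x * (y + z) = x * y + x * z"
    by (transfer, auto intro!: blinfun_eqI simp: blinfun.add_left blinfun.add_right)+
  show "r *\<^sub>R (x + y) = r *\<^sub>R x + r *\<^sub>R y" "(r + s) *\<^sub>R x = r *\<^sub>R x + s *\<^sub>R x"
    "r *\<^sub>R s *\<^sub>R x = (r * s) *\<^sub>R x" "1 *\<^sub>R x = x"
    by (transfer, simp add: algebra_simps)+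
  show "r *\<^sub>R x * y = r *\<^sub>R (x * y)" "x * r *\<^sub>R y = r *\<^sub>R (x * y)"
    by (transfer, auto intro!: blinfun_eqI simp: blinfun.scaleR_left blinfun.scaleR_right)+
  show "c *\<^sub>C (x + y) = c *\<^sub>C x + c *\<^sub>C y" "(c + d) *\<^sub>C x = c *\<^sub>C x + d *\<^sub>C x"
    "c *\<^sub>C d *\<^sub>C x = (c * d) *\<^sub>C x" "complex_of_real r *\<^sub>C x = r *\<^sub>R x"
    "norm (c *\<^sub>C x) = cmod c * norm x"
    by (transfer, simp add: scaleC_add_right scaleC_add_left scaleC_scaleC scaleC_of_real norm_scaleC)+
  show "dist x y = norm (x - y)" "sgn x = inverse (norm x) *\<^sub>R x"
    by (simp_all add: dist_clop_def sgn_clop_def)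
  show "norm x = 0 \<longleftrightarrow> x = 0" "norm (x + y) \<le> norm x + norm y" "norm (r *\<^sub>R x) = \<bar>r\<bar> * norm x"
    "norm (x * y) \<le> norm x * norm y"
    by (transfer, simp add: norm_triangle_ineq norm_blinfun_compose)+
  show "uniformity = (INF e\<in>{0<..}. principal {(x :: 'a clop, y). dist x y < e})"
    by (rule uniformity_clop_def)
  show "open U \<longleftrightarrow> (\<forall>x\<in>U. \<forall>\<^sub>F (x', y) in uniformity. x' = x \<longrightarrow> y \<in> U)"
    by (rule open_clop_def)
qed

end

instance clop :: (complex_banach) complex_banach_algebra
proof
  fix x y :: "'a clop" and c :: complex
  show "(c *\<^sub>C x) * y = c *\<^sub>C (x * y)" "x * (c *\<^sub>C y) = c *\<^sub>C (x * y)"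
    by (transfer, auto intro!: blinfun_eqI simp: scaleC_blinfun.rep_eq complex_linear_def)+
next
  fix X :: "nat \<Rightarrow> 'a clop"
  assume "Cauchy X"
  then have "Cauchy (\<lambda>n. op_of (X n))"
    by (simp add: Cauchy_def dist_norm norm_clop.rep_eq minus_clop.rep_eq)
  then obtain T where T: "(\<lambda>n. op_of (X n)) \<longlonglongrightarrow> T"
    by (auto simp: Cauchy_convergent_iff convergent_def)
  have "blinfun_apply T (c *\<^sub>C v) = c *\<^sub>C blinfun_apply T v" for c v
  proof (rule LIMSEQ_unique)
    show "(\<lambda>n. blinfun_apply (op_of (X n)) (c *\<^sub>C v)) \<longlonglongrightarrow> blinfun_apply T (c *\<^sub>C v)"
      by (intro tendsto_intros T)
    have "blinfun_apply (op_of (X n)) (c *\<^sub>C v) = c *\<^sub>C blinfun_apply (op_of (X n)) v" for n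
      using op_of[of "X n"] by (simp add: complex_linear_def)
    then show "(\<lambda>n. blinfun_apply (op_of (X n)) (c *\<^sub>C v)) \<longlonglongrightarrow> c *\<^sub>C blinfun_apply T v"
      by (simp add: scaleC.tendsto[OF tendsto_const] blinfun.tendsto T)
  qed
  then have "op_of (Clop T) = T"
    by (intro Clop_inverse) (simp add: complex_linear_def)
  then have "X \<longlonglongrightarrow> Clop T"
    using T by (simp add: LIMSEQ_iff norm_clop.rep_eq minus_clop.rep_eq)
  then show "convergent X"
    by (rule convergentI)
qed

lemmas op_of_simps = zero_clop.rep_eq one_clop.rep_eq plus_clop.rep_eq minus_clop.rep_eq
  uminus_clop.rep_eq times_clop.rep_eq scaleR_clop.rep_eq scaleC_clop.rep_eq

abbreviation app :: "'a::complex_banach clop \<Rightarrow> 'a \<Rightarrow> 'a" where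
  "app t \<equiv> blinfun_apply (op_of t)"

lemma app_simps:
  "app 0 v = 0" "app 1 v = v" "app (x + y) v = app x v + app y v" "app (x - y) v = app x v - app y v"
  "app (x * y) v = app x (app y v)" "app (c *\<^sub>C x) v = c *\<^sub>C app x v" "app x (c *\<^sub>C v) = c *\<^sub>C app x v"
  using op_of[of x]
  by (simp_all add: op_of_simps blinfun.add_left blinfun.diff_left scaleC_blinfun.rep_eq complex_linear_def)

lemma clop_eqI: "(\<And>v. app x v = app y v) \<Longrightarrow> x = y"
  by (metis blinfun_eqI op_of_inject)

lemma norm_app: "norm (app x v) \<le> norm x * norm v"
  using norm_blinfun[of "op_of x" v] by (simp add: norm_clop.rep_eq)

lemma bounded_linear_op_of: "bounded_linear op_of"
  by (rule bounded_linear_intro[of _ 1]) (simp_all add: op_of_simps norm_clop.rep_eq)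

lemma op_of_power: "op_of (x ^ n) = blinfun_power (op_of x) n"
  by (induction n) (simp_all add: blinfun_power_def op_of_simps)

lemma inverse_complex_linear:
  assumes "complex_linear T" and "is_blinfun_inverse T S"
  shows "complex_linear S"
  unfolding complex_linear_def
proof (intro allI)
  fix c v
  have TS: "blinfun_apply T (blinfun_apply S v) = v" and ST: "blinfun_apply S (blinfun_apply T v) = v" for v
    using assms(2) unfolding is_blinfun_inverse_def
    by (metis blinfun_apply_blinfun_compose blinfun_apply_id_blinfun)+
  have "blinfun_apply S (c *\<^sub>C v) = blinfun_apply S (blinfun_apply T (c *\<^sub>C blinfun_apply S v))"
    using assms(1) TS by (simp add: complex_linear_def)
  then show "blinfun_apply S (c *\<^sub>C v) = c *\<^sub>C blinfun_apply S v"
    by (simp add: ST)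
qed

lemma is_blinfun_inverse_iff: "is_blinfun_inverse (op_of x) S \<longleftrightarrow> (\<exists>y. S = op_of y \<and> is_inverse x y)"
proof
  assume inv: "is_blinfun_inverse (op_of x) S"
  then have "complex_linear S"
    using inverse_complex_linear op_of[of x] by auto
  then have S: "op_of (Clop S) = S"
    by (intro Clop_inverse) simp
  then have "is_inverse x (Clop S)"
    using inv by (simp add: is_blinfun_inverse_def is_inverse_def op_of_simps flip: op_of_inject)
  then show "\<exists>y. S = op_of y \<and> is_inverse x y"
    using S by metis
qed (auto simp: is_blinfun_inverse_def is_inverse_def simp flip: op_of_simps)

lemma shifted_op_of: "\<zeta> *\<^sub>C id_blinfun - op_of x = op_of (\<zeta> *\<^sub>C 1 - x)"
  by (simp add: op_of_simps)

lemma spectrum_op_of: "spectrum (op_of x) = spec x"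
  unfolding spectrum_def spec_def shifted_op_of is_blinfun_inverse_iff by blast

lemma resolvent_op_of: "\<zeta> \<notin> spec x \<Longrightarrow> resolvent (op_of x) \<zeta> = op_of (rsv x \<zeta>)"
  unfolding resolvent_def shifted_op_of is_blinfun_inverse_iff
  using is_inverse_rsv is_inverse_unique by (intro the_equality) blast+

text \<open>
  The choice of the radius in \<open>eigenprojection\<close> is resolved here once and for all. The isometric embedding
  \<open>op_of\<close> commutes with the integral.
\<close>

lemma eigenprojection_op_of:
  assumes "\<mu> isolated_in spec x"
  shows "\<exists>r>0. spec x \<inter> cball \<mu> r \<subseteq> {\<mu>} \<and> eigenprojection (op_of x) \<mu> = op_of (riesz x \<mu> r)"
proof -
  define r where "r = (SOME r. 0 < r \<and> spec x \<inter> cball \<mu> r \<subseteq> {\<mu>})"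
  obtain T where "open T" "T \<inter> spec x = {\<mu>}"
    using assms by (auto simp: isolated_in_def)
  then obtain e where "0 < e" "cball \<mu> e \<subseteq> T"
    by (metis Int_iff insertI1 open_contains_cball_eq)
  with \<open>T \<inter> spec x = {\<mu>}\<close> have "\<exists>r. 0 < r \<and> spec x \<inter> cball \<mu> r \<subseteq> {\<mu>}"
    by blast
  then have r: "0 < r" "spec x \<inter> cball \<mu> r \<subseteq> {\<mu>}"
    unfolding r_def by (metis (mono_tags, lifting) someI_ex)+
  note sub = sphere_outside_spec[OF r]
  have cont: "continuous_on (sphere \<mu> r) (\<lambda>\<zeta>. (\<zeta> - \<mu>) *\<^sub>C rsv x \<zeta>)"
    by (intro continuous_intros continuous_on_subset[OF continuous_on_rsv sub])
  have "eigenprojection (op_of x) \<mu> = circle_mean \<mu> r (\<lambda>\<zeta>. (\<zeta> - \<mu>) *\<^sub>C resolvent (op_of x) \<zeta>)"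
    unfolding eigenprojection_def spectrum_op_of circle_mean_def r_def[symmetric] Let_def by simp
  also have "\<dots> = circle_mean \<mu> r (\<lambda>\<zeta>. op_of ((\<zeta> - \<mu>) *\<^sub>C rsv x \<zeta>))"
  proof (rule circle_mean_cong)
    fix \<zeta> assume "cmod (\<zeta> - \<mu>) = r"
    then have "\<zeta> \<notin> spec x"
      using sub by (auto simp: dist_norm norm_minus_commute)
    then show "(\<zeta> - \<mu>) *\<^sub>C resolvent (op_of x) \<zeta> = op_of ((\<zeta> - \<mu>) *\<^sub>C rsv x \<zeta>)"
      by (simp add: resolvent_op_of op_of_simps)
  qed (use r in simp)
  also have "\<dots> = op_of (riesz x \<mu> r)"
    unfolding riesz_def using r by (intro circle_mean_bounded_linear bounded_linear_op_of cont) auto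
  finally show ?thesis
    using r by blast
qed

section \<open>Simple top eigenvalues and rank one projections\<close>

text \<open>
  With \<open>p * p = p\<close>, the operator \<open>p\<close> is a projection onto the line through \<open>w\<close>.
\<close>

definition spans :: "'a::complex_banach \<Rightarrow> 'a clop \<Rightarrow> bool" where
  "spans w p \<longleftrightarrow> w \<noteq> 0 \<and> range (app p) = range (\<lambda>c. c *\<^sub>C w)"

lemma spans_nonzero: "spans w p \<Longrightarrow> p \<noteq> 0"
proof
  assume "spans w p" "p = 0"
  moreover have "w \<in> range (\<lambda>c. c *\<^sub>C w)"
    by (rule range_eqI[of _ _ 1]) simp
  ultimately show False
    by (auto simp: spans_def app_simps)
qed

lemma spans_fixed:
  assumes "spans w p" and "p * p = p"
  shows "app p w = w"
proof -
  have "w \<in> range (\<lambda>c. c *\<^sub>C w)"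
    by (rule range_eqI[of _ _ 1]) simp
  then obtain x where "w = app p x"
    using assms(1) by (auto simp: spans_def)
  then show ?thesis
    using assms(2) by (metis app_simps(5))
qed

lemma spans_obtain:
  assumes "spans w p"
  obtains c where "app p x = c *\<^sub>C w"
  using assms unfolding spans_def by blast

lemma spans_commuting_eigenvalue:
  assumes "spans w p" and "p * p = p" and "t * p = p * t"
  shows "\<exists>\<mu>. t * p = \<mu> *\<^sub>C p"
proof -
  have "app p (app t w) = app t w"
    using spans_fixed[OF assms(1,2)] assms(3) by (metis app_simps(5))
  then obtain \<mu> where \<mu>: "app t w = \<mu> *\<^sub>C w"
    using spans_obtain[OF assms(1)] by metis
  have "t * p = \<mu> *\<^sub>C p"
  proof (rule clop_eqI)
    fix x
    obtain c where "app p x = c *\<^sub>C w"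
      using assms(1) by (rule spans_obtain)
    then show "app (t * p) x = app (\<mu> *\<^sub>C p) x"
      by (simp add: app_simps \<mu> scaleC_scaleC mult.commute)
  qed
  then show ?thesis ..
qed

text \<open>
  If \<open>p'\<close> is at distance less than \<open>1\<close> from \<open>p\<close>, then \<open>p\<close> is injective on the range of \<open>p'\<close>, so this
  range has dimension at most one; it is not zero since \<open>p'\<close> does not vanish at \<open>w\<close>.
\<close>

lemma spans_near:
  assumes "spans w p" and "p * p = p" and "p' * p' = p'" and "norm (p' - p) < 1"
  shows "\<exists>w'. spans w' p'"
proof -
  have contract: "norm (app (p' - p) v) < norm v" if "v \<noteq> 0" for v
  proof -
    have "norm (p' - p) * norm v < 1 * norm v"
      using assms(4) that by (intro mult_strict_right_mono) auto
    then show ?thesis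
      using norm_app[of "p' - p" v] by simp
  qed
  have inj: "v = 0" if "app p' v = v" "app p v = 0" for v
    using contract[of v] that by (auto simp: app_simps)
  let ?w = "app p' w"
  have w: "w \<noteq> 0" and pw: "app p w = w"
    using assms(1) spans_fixed[OF assms(1,2)] by (auto simp: spans_def)
  have "?w \<noteq> 0"
    using contract[OF w] pw by (auto simp: app_simps)
  moreover have idem: "app p' (app p' v) = app p' v" for v
    using assms(3) by (metis app_simps(5))
  obtain d where d: "app p ?w = d *\<^sub>C w"
    using assms(1) by (rule spans_obtain)
  then have "d \<noteq> 0"
    using inj[of ?w] idem \<open>?w \<noteq> 0\<close> by auto
  have "range (app p') = range (\<lambda>c. c *\<^sub>C ?w)"
  proof (intro equalityI subsetI)
    fix v assume "v \<in> range (\<lambda>c. c *\<^sub>C ?w)"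
    then show "v \<in> range (app p')"
      by (auto simp flip: app_simps(7))
  next
    fix v assume "v \<in> range (app p')"
    then have v: "app p' v = v" using idem by auto
    obtain c where c: "app p v = c *\<^sub>C w"
      using assms(1) by (rule spans_obtain)
    have "v - (c / d) *\<^sub>C ?w = 0"
    proof (rule inj)
      show "app p' (v - (c / d) *\<^sub>C ?w) = v - (c / d) *\<^sub>C ?w"
        by (simp add: blinfun.diff_right app_simps v idem)
      show "app p (v - (c / d) *\<^sub>C ?w) = 0"
        using \<open>d \<noteq> 0\<close> by (simp add: blinfun.diff_right app_simps c d scaleC_scaleC)
    qed
    then have "v = (c / d) *\<^sub>C ?w" by simp
    then show "v \<in> range (\<lambda>c. c *\<^sub>C ?w)" by (rule range_eqI)
  qed
  then show ?thesis
    using \<open>?w \<noteq> 0\<close> by (auto simp: spans_def)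
qed

text \<open>
  The eigenprojection \<open>p\<close> fixes an eigenvector \<open>u\<close>, by the reduced resolvent. As the range of \<open>p\<close> is a
  line, it is the line through \<open>u\<close>, and this yields both \<open>p * p = p\<close> and \<open>t * p = \<mu> *\<^sub>C p\<close> without the
  usual double contour integral.
\<close>

lemma simple_top_eigenvalue_imp_dominant:
  assumes "simple_top_eigenvalue (op_of t) \<mu>"
  shows "\<exists>p w. dominant t \<mu> p \<and> spans w p \<and> eigenprojection (op_of t) \<mu> = op_of p"
proof -
  obtain \<rho> u v where iso: "\<mu> isolated_in spec t" and u: "u \<noteq> 0" "app t u = \<mu> *\<^sub>C u"
    and v: "v \<noteq> 0" "range (blinfun_apply (eigenprojection (op_of t) \<mu>)) = range (\<lambda>c. c *\<^sub>C v)"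
    and \<rho>: "0 \<le> \<rho>" "\<rho> < cmod \<mu>" "spec t - {\<mu>} \<subseteq> cball 0 \<rho>"
    using assms unfolding simple_top_eigenvalue_def isolated_simple_eigenvalue_def eigenvalue_def spectrum_op_of
    by blast
  obtain r where r: "0 < r" "spec t \<inter> cball \<mu> r \<subseteq> {\<mu>}"
    and proj: "eigenprojection (op_of t) \<mu> = op_of (riesz t \<mu> r)"
    using eigenprojection_op_of[OF iso] by auto
  define p where "p = riesz t \<mu> r"
  have spans_v: "spans v p"
    using v proj by (simp add: spans_def p_def)
  have pu: "app p u = u"
  proof -
    obtain s where s: "s * (\<mu> *\<^sub>C 1 - t) = 1 - p"
      using reduced_resolvent[OF r] unfolding p_def by blast
    have "app (1 - p) u = app s (app (\<mu> *\<^sub>C 1 - t) u)"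
      by (metis s app_simps(5))
    also have "\<dots> = 0"
      by (simp add: app_simps u)
    finally show ?thesis
      by (simp add: app_simps)
  qed
  obtain c where c: "u = c *\<^sub>C v"
    using spans_v pu by (metis spans_obtain)
  have line: "\<exists>d. app p x = d *\<^sub>C u" for x
  proof -
    obtain d where "app p x = d *\<^sub>C v"
      using spans_v by (rule spans_obtain)
    then have "app p x = (d / c) *\<^sub>C u"
      using c u(1) by (auto simp: scaleC_scaleC)
    then show ?thesis ..
  qed
  have pp: "p * p = p"
  proof (rule clop_eqI)
    fix x
    show "app (p * p) x = app p x"
      using line[of x] by (auto simp: app_simps pu)
  qed
  have comm: "t * p = p * t"
    unfolding p_def using riesz_commutes[OF r, of t] by simp
  have tp: "t * p = \<mu> *\<^sub>C p"
  proof (rule clop_eqI)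
    fix x
    show "app (t * p) x = app (\<mu> *\<^sub>C p) x"
      using line[of x] by (auto simp: app_simps u scaleC_scaleC mult.commute)
  qed
  have "spec (t * (1 - p)) \<subseteq> cball 0 \<rho>"
    using spec_complement[OF r p_def pp] \<rho> by auto
  then have "geometric_below (t * (1 - p)) (cmod \<mu>)"
    using \<rho> by (intro spec_geometric_below)
  then have "dominant t \<mu> p"
    using pp tp comm by (simp add: dominant_def)
  then show ?thesis
    using spans_v proj p_def by blast
qed

lemma dominant_imp_simple_top_eigenvalue:
  assumes "dominant t \<mu> p" and "spans w p"
  shows "simple_top_eigenvalue (op_of t) \<mu>" and "eigenprojection (op_of t) \<mu> = op_of p"
proof -
  obtain \<rho> where \<rho>: "0 \<le> \<rho>" "\<rho> < cmod \<mu>" "spec t - {\<mu>} \<subseteq> cball 0 \<rho>"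
    using dominant_spec[OF assms(1)] by auto
  have p: "p * p = p" "t * p = \<mu> *\<^sub>C p"
    using assms(1) by (auto simp: dominant_def)
  have w: "w \<noteq> 0" "app p w = w"
    using assms(2) spans_fixed[OF assms(2) p(1)] by (auto simp: spans_def)
  then have tw: "app t w = \<mu> *\<^sub>C w"
    using p(2) by (metis app_simps(5,6))
  have "\<mu> \<in> spec t"
  proof (rule ccontr)
    assume "\<mu> \<notin> spec t"
    then have "app (rsv t \<mu> * (\<mu> *\<^sub>C 1 - t)) w = w"
      using is_inverse_rsv by (metis is_inverse_def app_simps(2))
    then show False
      using w tw by (simp add: app_simps)
  qed
  moreover have "ball \<mu> (cmod \<mu> - \<rho>) \<inter> spec t \<subseteq> {\<mu>}"
  proof
    fix \<zeta> assume \<zeta>: "\<zeta> \<in> ball \<mu> (cmod \<mu> - \<rho>) \<inter> spec t"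
    then have "cmod (\<mu> - \<zeta>) < cmod \<mu> - \<rho>" by (simp add: dist_norm)
    then have "\<not> cmod \<zeta> \<le> \<rho>"
      using norm_triangle_sub[of \<mu> \<zeta>] by linarith
    then show "\<zeta> \<in> {\<mu>}"
      using \<rho>(3) \<zeta> by auto
  qed
  ultimately have iso: "\<mu> isolated_in spec t"
    unfolding isolated_in_def using \<rho>(2)
    by (intro conjI exI[of _ "ball \<mu> (cmod \<mu> - \<rho>)"]) auto
  show proj: "eigenprojection (op_of t) \<mu> = op_of p"
    using eigenprojection_op_of[OF iso] dominant_riesz[OF assms(1)] by auto
  show "simple_top_eigenvalue (op_of t) \<mu>"
    unfolding simple_top_eigenvalue_def isolated_simple_eigenvalue_def eigenvalue_def spectrum_op_of proj
    using iso \<rho> w(1) tw assms(2) by (auto simp: spans_def)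
qed

text \<open>
  The rank one projection \<open>p'\<close> obtained by perturbation commutes with \<open>t'\<close>, so it has an eigenvalue
  \<open>\<mu>'\<close>. The \<open>N\<close>-th powers compare as required: \<open>\<mu>' ^ N\<close> is at least three quarters of \<open>\<mu> ^ N\<close> in modulus,
  whereas the complementary part is at most a quarter of it.
\<close>

lemma dominant_stable:
  assumes "dominant t \<mu> p" and "spans w p" and "0 < e"
  shows "\<exists>h>0. \<forall>t'. norm (t' - t) < h \<longrightarrow> (\<exists>\<mu>' p' w'. dominant t' \<mu>' p' \<and> spans w' p' \<and> norm (p' - p) < e)"
proof -
  have p: "p * p = p" using assms(1) by (simp add: dominant_def)
  have \<mu>: "0 < cmod \<mu>"
    using assms(1) by (auto simp: dominant_def geometric_below_def)
  obtain h where "h > 0" and h: "\<And>t'. norm (t' - t) < h \<Longrightarrow> \<exists>p' N. N \<ge> 1 \<and> p' * p' = p' \<and>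
      t' * p' = p' * t' \<and> norm (p' - p) < min e 1 \<and> norm ((t' * (1 - p')) ^ N) \<le> cmod \<mu> ^ N / 4 \<and>
      norm (t' ^ N * p' - \<mu> ^ N *\<^sub>C p') \<le> cmod \<mu> ^ N / 4 * norm p'"
    using dominant_perturbation[OF assms(1), of "min e 1"] assms(3) by auto
  show ?thesis
  proof (intro exI[of _ h] conjI allI impI)
    fix t' assume "norm (t' - t) < h"
    from h[OF this] obtain p' N where N: "N \<ge> 1" and p': "p' * p' = p'" "t' * p' = p' * t'"
      "norm (p' - p) < e" "norm (p' - p) < 1"
      and compl: "norm ((t' * (1 - p')) ^ N) \<le> cmod \<mu> ^ N / 4"
      and top: "norm (t' ^ N * p' - \<mu> ^ N *\<^sub>C p') \<le> cmod \<mu> ^ N / 4 * norm p'"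
      by auto
    obtain w' where w': "spans w' p'"
      using spans_near[OF assms(2) p p'(1,4)] by blast
    obtain \<mu>' where \<mu>': "t' * p' = \<mu>' *\<^sub>C p'"
      using spans_commuting_eigenvalue[OF w' p'(1,2)] by blast
    have "t' ^ n * p' = \<mu>' ^ n *\<^sub>C p'" for n
      by (induction n) (simp_all add: \<mu>' mult.assoc scaleC_mult_right scaleC_scaleC mult.commute)
    then have "t' ^ N * p' - \<mu> ^ N *\<^sub>C p' = (\<mu>' ^ N - \<mu> ^ N) *\<^sub>C p'"
      by (simp add: scaleC.diff_left)
    then have "cmod (\<mu>' ^ N - \<mu> ^ N) * norm p' \<le> cmod \<mu> ^ N / 4 * norm p'"
      using top by (simp add: norm_scaleC)
    then have "cmod (\<mu>' ^ N - \<mu> ^ N) \<le> cmod \<mu> ^ N / 4"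
      using spans_nonzero[OF w'] by (simp add: mult_le_cancel_right)
    moreover have "cmod (\<mu> ^ N) \<le> cmod (\<mu>' ^ N) + cmod (\<mu>' ^ N - \<mu> ^ N)"
      using norm_triangle_sub[of "\<mu> ^ N" "\<mu>' ^ N"] by (simp add: norm_minus_commute)
    moreover have pos: "0 < cmod \<mu> ^ N"
      using \<mu> by simp
    ultimately have "cmod \<mu> ^ N / 4 < cmod \<mu>' ^ N"
      by (simp add: norm_power)
    then have "norm ((t' * (1 - p')) ^ N) < cmod \<mu>' ^ N"
      using compl by simp
    moreover from \<open>cmod \<mu> ^ N / 4 < cmod \<mu>' ^ N\<close> have "0 < cmod \<mu>'"
      using pos N by (cases "\<mu>' = 0") (auto simp: power_0_left)
    ultimately have "geometric_below (t' * (1 - p')) (cmod \<mu>')"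
      using N by (intro geometric_below_of_power) auto
    then have "dominant t' \<mu>' p'"
      using p' \<mu>' by (simp add: dominant_def)
    then show "\<exists>\<mu>' p' w'. dominant t' \<mu>' p' \<and> spans w' p' \<and> norm (p' - p) < e"
      using w' p'(3) by blast
  qed fact
qed

lemma simple_top_eigenvalue_unique:
  assumes "simple_top_eigenvalue T \<mu>" and "simple_top_eigenvalue T \<nu>"
  shows "\<mu> = \<nu>"
proof (rule ccontr)
  assume "\<mu> \<noteq> \<nu>"
  have dominates: "cmod b < cmod a"
    if a: "simple_top_eigenvalue T a" and b: "simple_top_eigenvalue T b" and "a \<noteq> b" for a b
  proof -
    obtain \<rho> where "\<rho> < cmod a" "spectrum T - {a} \<subseteq> cball 0 \<rho>"
      using a unfolding simple_top_eigenvalue_def by blast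
    moreover have "b \<in> spectrum T"
      using b by (auto simp: simple_top_eigenvalue_def isolated_simple_eigenvalue_def isolated_in_def)
    ultimately show ?thesis
      using \<open>a \<noteq> b\<close> by force
  qed
  show False
    using dominates[OF assms] dominates[OF assms(2,1)] \<open>\<mu> \<noteq> \<nu>\<close> by auto
qed

lemma top_eigenvalue_eqI: "simple_top_eigenvalue T \<mu> \<Longrightarrow> top_eigenvalue T = \<mu>"
  unfolding top_eigenvalue_def by (blast intro: simple_top_eigenvalue_unique)

section \<open>One-parameter semigroups\<close>

lemma semigroup_power:
  fixes g :: "real \<Rightarrow> 'b::monoid_mult"
  assumes "g 0 = 1" and "\<And>s t. 0 \<le> s \<Longrightarrow> 0 \<le> t \<Longrightarrow> g (s + t) = g s * g t" and "0 \<le> s"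
  shows "g (real n * s) = g s ^ n"
proof (induction n)
  case (Suc n)
  have "g (real (Suc n) * s) = g (s + real n * s)"
    by (simp add: algebra_simps)
  also have "\<dots> = g s * g s ^ n"
    using assms Suc by simp
  finally show ?case by simp
qed (use assms in simp)

lemma scalar_semigroup_continuous:
  fixes m :: "real \<Rightarrow> complex"
  assumes zero: "m 0 = 1" and add: "\<And>s t. 0 \<le> s \<Longrightarrow> 0 \<le> t \<Longrightarrow> m (s + t) = m s * m t"
    and lim: "(m \<longlongrightarrow> 1) (at_right 0)"
  shows "continuous_on {0..} m"
proof -
  have right: "(m \<longlongrightarrow> m t) (at_right t)" if "0 \<le> t" for t
  proof -
    have "((\<lambda>x. m x * m t) \<longlongrightarrow> 1 * m t) (at_right 0)"
      by (intro tendsto_intros lim)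
    moreover have "\<forall>\<^sub>F x in at_right 0. m x * m t = m (x + t)"
      using that add by (auto simp: eventually_at_filter)
    ultimately show ?thesis
      unfolding filterlim_at_right_to_0[of _ _ t] by (auto intro: Lim_transform_eventually)
  qed
  have left: "(m \<longlongrightarrow> m t) (at_left t)" if "0 < t" for t
  proof -
    have "filterlim (\<lambda>s. t - s) (at_right 0) (at_left t)"
      unfolding filterlim_at
      by (auto simp: eventually_at_filter intro!: tendsto_eq_intros)
    from filterlim_compose[OF lim this] have lim': "((\<lambda>s. m (t - s)) \<longlongrightarrow> 1) (at_left t)" .
    then have "((\<lambda>s. m t / m (t - s)) \<longlongrightarrow> m t / 1) (at_left t)"
      by (intro tendsto_intros) auto
    moreover have "\<forall>\<^sub>F s in at_left t. m t / m (t - s) = m s"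
    proof -
      have "\<forall>\<^sub>F s in at_left t. m (t - s) \<noteq> 0"
        using lim' by (rule tendsto_imp_eventually_ne) simp
      moreover have "\<forall>\<^sub>F s in at_left t. 0 < s \<and> s < t"
        using eventually_at_left_real[OF \<open>0 < t\<close>] by simp
      ultimately show ?thesis
      proof eventually_elim
        case (elim s)
        then show ?case using add[of "t - s" s] by simp
      qed
    qed
    ultimately show ?thesis
      by (auto intro: Lim_transform_eventually)
  qed
  show ?thesis
    unfolding continuous_on_def
  proof
    fix t :: real assume "t \<in> {0..}"
    show "(m \<longlongrightarrow> m t) (at t within {0..})"
    proof (cases "t = 0")
      case True
      then show ?thesis using right[of 0] by (simp add: at_within_Ici_at_right)
    next
      case False
      then have "(m \<longlongrightarrow> m t) (at t)"
        using \<open>t \<in> {0..}\<close> by (intro filterlim_split_at left right) auto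
      then show ?thesis by (rule tendsto_within_subset) simp
    qed
  qed
qed

text \<open>
  The classical smoothing argument: with \<open>F\<close> the primitive of \<open>m\<close>, the functional equation integrates to
  \<open>F (t + h) - F t = m t * F h\<close>, so \<open>m\<close> is differentiable as soon as \<open>F h \<noteq> 0\<close> for some \<open>h\<close>. Then
  \<open>m\<close> solves a linear differential equation.
\<close>

lemma scalar_semigroup_exp:
  fixes m :: "real \<Rightarrow> complex"
  assumes zero: "m 0 = 1" and add: "\<And>s t. 0 \<le> s \<Longrightarrow> 0 \<le> t \<Longrightarrow> m (s + t) = m s * m t"
    and lim: "(m \<longlongrightarrow> 1) (at_right 0)"
  shows "\<exists>a. \<forall>t\<ge>0. m t = exp (of_real t * a)"
proof -
  note cont = scalar_semigroup_continuous[OF assms]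
  have cont': "continuous_on {s..b} m" if "0 \<le> s" for s b
    using that by (intro continuous_on_subset[OF cont]) auto
  define F where "F t = integral {0..t} m" for t
  have F: "(F has_vector_derivative m x) (at x within {0..b})" if "x \<in> {0..b}" for x b
    unfolding F_def by (rule integral_has_vector_derivative) (use that cont' in auto)
  obtain h where h: "0 < h" "F h \<noteq> 0"
  proof -
    have False if "\<And>h. 0 < h \<Longrightarrow> F h = 0"
    proof -
      have "F x = 0" if "x \<in> {0..1}" for x
        using that \<open>\<And>h. 0 < h \<Longrightarrow> F h = 0\<close> by (cases "x = 0") (auto simp: F_def)
      then have "(F has_vector_derivative 0) (at 0 within {0..1})"
        by (intro has_vector_derivative_transform[OF _ _ has_vector_derivative_const[of 0]]) auto
      then have "m 0 = 0"
        using F[of 0 1] vector_derivative_unique_within_closed_interval[of 0 1 0 F] by auto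
      then show False using zero by simp
    qed
    then show ?thesis using that by blast
  qed
  have shift: "F (t + h) - F t = m t * F h" if "0 \<le> t" for t
  proof -
    have "(m has_integral F (t + h) - F t) {t..t + h}"
    proof -
      have "integral {0..t} m + integral {t..t + h} m = integral {0..t + h} m"
        using that h(1) by (intro Henstock_Kurzweil_Integration.integral_combine integrable_continuous_interval cont') auto
      moreover have "m integrable_on {t..t + h}"
        using that by (intro integrable_continuous_interval cont')
      ultimately show ?thesis
        by (simp add: F_def has_integral_iff algebra_simps)
    qed
    from has_integral_shift_real_ivl[OF this, of t]
    have "((\<lambda>x. m (x + t)) has_integral F (t + h) - F t) {0..h}" by simp
    then have "((\<lambda>x. m t * m x) has_integral F (t + h) - F t) {0..h}"
      by (rule has_integral_eq[rotated]) (use that add in \<open>simp add: mult.commute\<close>)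
    moreover have "((\<lambda>x. m t * m x) has_integral m t * F h) {0..h}"
      unfolding F_def by (intro has_integral_mult_right integrable_integral
          integrable_continuous_interval cont') simp
    ultimately show ?thesis
      by (rule has_integral_unique)
  qed
  define a where "a = (m h - 1) / F h"
  have m_eq: "m t = (F (t + h) - F t) / F h" if "0 \<le> t" for t
    using shift[OF that] h by simp
  have deriv: "(m has_vector_derivative a * m x) (at x within {0..b})" if x: "x \<in> {0..b}" for x b
  proof -
    have "((\<lambda>t. F (t + h)) has_vector_derivative m (x + h)) (at x within {0..b})"
    proof -
      have "(F has_vector_derivative m (x + h)) (at (x + h) within {0..b + h})"
        using x h(1) by (intro F) auto
      then have "(F has_vector_derivative m (x + h)) (at (x + h) within (\<lambda>t. t + h) ` {0..b})"
        by (rule has_vector_derivative_within_subset) (use h in auto)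
      moreover have "((\<lambda>t. t + h) has_vector_derivative 1) (at x within {0..b})"
        by (auto intro!: derivative_eq_intros)
      ultimately show ?thesis
        using vector_diff_chain_within[of "\<lambda>t. t + h" 1 x "{0..b}" F "m (x + h)"] by (simp add: o_def)
    qed
    then have "((\<lambda>t. (F (t + h) - F t) / F h) has_vector_derivative (m (x + h) - m x) / F h) (at x within {0..b})"
      by (intro has_vector_derivative_divide has_vector_derivative_diff F x)
    moreover have "(m (x + h) - m x) / F h = a * m x"
      using add[of x h] x h by (simp add: a_def field_simps)
    ultimately show ?thesis
      using m_eq x by (auto intro: has_vector_derivative_transform[of x "{0..b}" m "\<lambda>t. (F (t + h) - F t) / F h"])
  qed
  have "m t = exp (of_real t * a)" if "0 \<le> t" for t
  proof -
    let ?g = "\<lambda>s. m s * exp (- (of_real s * a))"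
    have "(?g has_vector_derivative 0) (at x within {0..t})" if "x \<in> {0..t}" for x
    proof -
      have "((\<lambda>s. exp (- (complex_of_real s * a))) has_vector_derivative - a * exp (- (of_real x * a))) (at x within {0..t})"
        by (rule has_vector_derivative_real_field) (auto intro!: derivative_eq_intros)
      from has_vector_derivative_mult[OF deriv[OF that] this] show ?thesis
        by (simp add: algebra_simps)
    qed
    then obtain c where c: "\<And>s. s \<in> {0..t} \<Longrightarrow> ?g s = c"
      using has_vector_derivative_zero_constant[of "{0..t}" ?g] by auto
    have "?g t = ?g 0" using c[of t] c[of 0] that by simp
    then show ?thesis
      by (simp add: zero exp_minus field_simps)
  qed
  then show ?thesis by blast
qed

text \<open>
  Bounded near \<open>0\<close> by continuity, and then \<open>g f = g (f / n) ^ n\<close> with \<open>n\<close> independent of \<open>f\<close>.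
\<close>

lemma semigroup_bounded_unit_interval:
  fixes g :: "real \<Rightarrow> 'b::complex_banach_algebra"
  assumes "g 0 = 1" and "\<And>s t. 0 \<le> s \<Longrightarrow> 0 \<le> t \<Longrightarrow> g (s + t) = g s * g t" and "(g \<longlongrightarrow> 1) (at_right 0)"
  shows "\<exists>M>0. \<forall>f\<in>{0..1}. norm (g f) \<le> M"
proof -
  let ?B = "norm (1::'b) + 1"
  have "\<forall>\<^sub>F s in at_right 0. norm (g s) < ?B"
    using tendsto_norm[OF assms(3)] by (rule order_tendstoD(2)) simp
  then obtain e where e: "0 < e" "\<And>s. 0 < s \<Longrightarrow> s < e \<Longrightarrow> norm (g s) < ?B"
    by (auto simp: eventually_at_right_field)
  obtain n :: nat where n: "0 < n" "1 / real n < e"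
    using e(1) by (metis nat_approx_posE zero_less_Suc)
  have "norm (g f) \<le> norm (1::'b) * ?B ^ n" if "f \<in> {0..1}" for f
  proof (cases "f = 0")
    case True
    have "norm (1::'b) * 1 \<le> norm (1::'b) * ?B ^ n"
      by (intro mult_left_mono one_le_power) auto
    then show ?thesis using True assms(1) by simp
  next
    case False
    have "f / n \<le> 1 / n"
      using that n by (intro divide_right_mono) auto
    then have "norm (g (f / n)) \<le> ?B"
      using False that n e(2)[of "f / n"] by simp
    moreover have "g f = g (f / n) ^ n"
      using semigroup_power[OF assms(1,2), of "f / n" n] that n by simp
    ultimately show ?thesis
      using norm_power_le[of "g (f / n)" n] power_mono[of "norm (g (f / n))" ?B n]
      by (smt (verit) mult_left_mono norm_ge_zero)
  qed
  then have "\<forall>f\<in>{0..1}. norm (g f) \<le> norm (1::'b) * ?B ^ n + 1"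
    by force
  moreover have "0 < norm (1::'b) * ?B ^ n + 1"
    by (intro add_nonneg_pos mult_nonneg_nonneg) auto
  ultimately show ?thesis by blast
qed

text \<open>
  Dominance at time \<open>1\<close> extends to all positive times with the same projection \<open>p\<close>. Each \<open>g t\<close>
  commutes with \<open>g 1\<close> and hence with the Riesz projection \<open>p\<close>; as \<open>p\<close> has rank one, \<open>g t\<close> acts on its
  range by a scalar \<open>m t\<close>, a continuous scalar semigroup, so \<open>m t = exp (t * a)\<close>. On the complement, the
  powers of \<open>g t\<close> differ from powers of \<open>g 1\<close> by a factor \<open>g f\<close> with \<open>f \<in> {0..1}\<close>, which is bounded.
  The number \<open>a\<close> is some logarithm of \<open>\<mu>\<close>, not necessarily the principal one.
\<close>

lemma semigroup_dominant:
  fixes g :: "real \<Rightarrow> 'a::complex_banach clop"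
  assumes zero: "g 0 = 1" and add: "\<And>s t. 0 \<le> s \<Longrightarrow> 0 \<le> t \<Longrightarrow> g (s + t) = g s * g t"
    and lim: "(g \<longlongrightarrow> 1) (at_right 0)"
    and dom: "dominant (g 1) \<mu> p" and spans: "spans w p"
  shows "\<exists>a. \<forall>t>0. dominant (g t) (exp (of_real t * a)) p"
proof -
  have p: "p * p = p" "g 1 * p = \<mu> *\<^sub>C p" "p * g 1 = \<mu> *\<^sub>C p"
    and geo: "geometric_below (g 1 * (1 - p)) (cmod \<mu>)"
    using dom by (auto simp: dominant_def)
  have \<mu>: "0 < cmod \<mu>"
    using geo by (auto simp: geometric_below_def)
  have "p \<noteq> 0"
    using spans by (rule spans_nonzero)
  \<comment> \<open>Commuting with \<open>g 1\<close> implies commuting with \<open>p\<close> because \<open>p\<close> is a Riesz projection, over a circle of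
    radius \<open>r\<close>.\<close>
  obtain r where r: "0 < r" "spec (g 1) \<inter> cball \<mu> r \<subseteq> {\<mu>}"
    using dominant_imp_simple_top_eigenvalue(1)[OF dom spans] eigenprojection_op_of[of \<mu> "g 1"]
    unfolding simple_top_eigenvalue_def isolated_simple_eigenvalue_def spectrum_op_of by blast
  have comm: "g t * p = p * g t" if "0 \<le> t" for t
  proof -
    have "g 1 * g t = g t * g 1"
      using add[of 1 t] add[of t 1] that by (simp add: add.commute)
    then show ?thesis
      using riesz_commutes[OF r] dominant_riesz[OF dom r] by metis
  qed
  then have "\<forall>t. \<exists>c. 0 \<le> t \<longrightarrow> g t * p = c *\<^sub>C p"
    using spans_commuting_eigenvalue[OF spans p(1)] by blast
  then obtain m where m: "\<And>t. 0 \<le> t \<Longrightarrow> g t * p = m t *\<^sub>C p"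
    by metis
  have "m 0 = 1"
    using m[of 0] zero \<open>p \<noteq> 0\<close> scaleC_cancel_right[of 1 p "m 0"] by simp
  moreover have "m (s + t) = m s * m t" if "0 \<le> s" "0 \<le> t" for s t
  proof -
    have "m (s + t) *\<^sub>C p = g s * (g t * p)"
      using that by (simp add: m[symmetric] add mult.assoc)
    also have "\<dots> = (m s * m t) *\<^sub>C p"
      using that by (simp add: m scaleC_mult_right scaleC_scaleC mult.commute)
    finally show ?thesis
      using \<open>p \<noteq> 0\<close> by (simp add: scaleC_cancel_right)
  qed
  moreover have "(m \<longlongrightarrow> 1) (at_right 0)"
  proof -
    have "((\<lambda>t. g t * p - p) \<longlongrightarrow> 1 * p - p) (at_right 0)"
      by (intro tendsto_intros lim)
    moreover have "\<forall>\<^sub>F t in at_right 0. g t * p - p = (m t - 1) *\<^sub>C p"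
      by (auto simp: eventually_at_filter m scaleC.diff_left)
    ultimately have "((\<lambda>t. (m t - 1) *\<^sub>C p) \<longlongrightarrow> 0) (at_right 0)"
      by (auto intro: Lim_transform_eventually)
    then have "((\<lambda>t. norm ((m t - 1) *\<^sub>C p) / norm p) \<longlongrightarrow> norm (0::'a clop) / norm p) (at_right 0)"
      by (intro tendsto_intros) (use \<open>p \<noteq> 0\<close> in auto)
    then have "((\<lambda>t. cmod (m t - 1)) \<longlongrightarrow> 0) (at_right 0)"
      using \<open>p \<noteq> 0\<close> by (simp add: norm_scaleC)
    then show ?thesis
      by (simp add: tendsto_norm_zero_iff LIM_zero_iff)
  qed
  ultimately obtain a where a: "\<And>t. 0 \<le> t \<Longrightarrow> m t = exp (of_real t * a)"
    using scalar_semigroup_exp[of m] by blast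
  have "\<mu> = exp a"
    using m[of 1] p(2) a[of 1] \<open>p \<noteq> 0\<close> scaleC_cancel_right[of \<mu> p "m 1"] by simp
  obtain M where M: "M > 0" "\<And>f. 0 \<le> f \<Longrightarrow> f \<le> 1 \<Longrightarrow> norm (g f) \<le> M"
    using semigroup_bounded_unit_interval[OF zero add lim] by auto
  \<comment> \<open>This absorbs the bound \<open>M\<close> on \<open>norm (g f)\<close> and a factor \<open>exp (f * Re a)\<close>, for \<open>f\<close> between \<open>0\<close> and \<open>1\<close>.\<close>
  define e where "e = exp (- \<bar>Re a\<bar>) / M"
  have "e > 0" using M(1) by (simp add: e_def)
  obtain k0 where k0: "\<And>k. k0 \<le> k \<Longrightarrow> norm ((g 1 * (1 - p)) ^ k) < e * cmod \<mu> ^ k"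
    using geometric_below_eventually[OF geo \<open>e > 0\<close>] by (auto simp: eventually_sequentially)
  have q: "(1 - p) * (1 - p) = 1 - p"
    using p(1) by (simp add: algebra_simps)
  have gq: "g t * (1 - p) = (1 - p) * g t" if "0 \<le> t" for t
    using comm[OF that] by (simp add: algebra_simps)
  have "dominant (g t) (exp (of_real t * a)) p" if "0 < t" for t
  proof -
    obtain n :: nat where n: "real (k0 + 1) / t \<le> real n" 
      using real_arch_simple by blast
    then have nt: "real (k0 + 1) \<le> real n * t"
      using that by (simp add: divide_le_eq)
    then have "n \<ge> 1"
      by (cases n) auto
    define k where "k = nat \<lfloor>real n * t\<rfloor>"
    define f where "f = real n * t - real k"
    have k: "k0 + 1 \<le> k"
      using nt by (simp add: k_def le_nat_floor)
    have f: "0 \<le> f" "f \<le> 1"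
      using that by (simp_all add: f_def k_def) linarith+
    have "(g t * (1 - p)) ^ n = g t ^ n * (1 - p)"
      using gq[of t] q \<open>n \<ge> 1\<close> that by (intro power_times_idempotent) auto
    also have "g t ^ n = g (real n * t)"
      using that semigroup_power[OF zero add, of t n] by simp
    also have "real n * t = f + real k * 1"
      by (simp add: f_def)
    also have "g (f + real k * 1) = g f * g 1 ^ k"
      using add[of f "real k * 1"] f semigroup_power[OF zero add, of 1 k] by simp
    also have "g f * g 1 ^ k * (1 - p) = g f * (g 1 * (1 - p)) ^ k"
      using power_times_idempotent[of "g 1" "1 - p" k] gq[of 1] q k by (simp add: mult.assoc)
    finally have "norm ((g t * (1 - p)) ^ n) \<le> norm (g f) * norm ((g 1 * (1 - p)) ^ k)"
      by (simp add: norm_mult_ineq)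
    also have "\<dots> \<le> M * norm ((g 1 * (1 - p)) ^ k)"
      using M(2) f by (intro mult_right_mono) auto
    also have "\<dots> < M * (e * cmod \<mu> ^ k)"
      using M(1) k0[of k] k by (intro mult_strict_left_mono) auto
    also have "\<dots> = exp (- \<bar>Re a\<bar>) * exp (Re a) ^ k"
      using M(1) by (simp add: e_def \<open>\<mu> = exp a\<close>)
    also have "\<dots> \<le> exp (f * Re a) * exp (Re a) ^ k"
    proof -
      have "\<bar>f * Re a\<bar> \<le> 1 * \<bar>Re a\<bar>"
        unfolding abs_mult using f by (intro mult_right_mono) auto
      then show ?thesis by simp
    qed
    also have "\<dots> = cmod (exp (of_real t * a)) ^ n"
    proof -
      have "f * Re a + real k * Re a = real n * (t * Re a)"
        by (simp add: f_def algebra_simps)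
      then show ?thesis
        by (simp add: exp_add[symmetric] exp_of_nat_mult[symmetric])
    qed
    finally have "geometric_below (g t * (1 - p)) (cmod (exp (of_real t * a)))"
      using \<open>n \<ge> 1\<close> by (intro geometric_below_of_power) auto
    then show ?thesis
      using p(1) m[of t] a[of t] comm[of t] that by (simp add: dominant_def)
  qed
  then show ?thesis by blast
qed

section \<open>The branch of the logarithm\<close>

lemma norm_integral_exp_le:
  fixes b :: real
  assumes "b \<noteq> 0"
  shows "cmod (integral {0..1} (\<lambda>\<eta>. exp (\<i> * of_real (b * (1 + \<eta>))))) \<le> 2 / \<bar>b\<bar>"
proof -
  define c where "c = \<i> * complex_of_real b"
  have "c \<noteq> 0" using assms by (simp add: c_def)
  let ?E = "\<lambda>\<eta>. exp (c * (1 + of_real \<eta>)) / c"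
  have "((\<lambda>\<eta>. exp (c * (1 + of_real \<eta>))) has_integral ?E 1 - ?E 0) {0..1}"
  proof (rule fundamental_theorem_of_calculus)
    fix x :: real
    show "(?E has_vector_derivative exp (c * (1 + of_real x))) (at x within {0..1})"
      by (rule has_vector_derivative_real_field)
        (use \<open>c \<noteq> 0\<close> in \<open>auto intro!: derivative_eq_intros\<close>)
  qed simp
  then have "integral {0..1} (\<lambda>\<eta>. exp (\<i> * of_real (b * (1 + \<eta>)))) = ?E 1 - ?E 0"
    by (intro integral_unique) (simp add: c_def mult.assoc)
  also have "cmod \<dots> \<le> cmod (?E 1) + cmod (?E 0)"
    by (rule norm_triangle_ineq4)
  also have "\<dots> = 2 / \<bar>b\<bar>"
    by (simp add: norm_divide norm_mult c_def)
  finally show ?thesis .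
qed

text \<open>
  Pointwise convergence of the oscillations on an interval excludes large frequencies: by dominated
  convergence the integrals tend to \<open>1\<close>, but those with frequency at least \<open>pi\<close> have modulus at most
  \<open>2 / pi < 1\<close>. Convergence for each \<open>\<eta>\<close> separately is what continuity of
  \<open>z \<mapsto> L z (1 + \<eta>)\<close> provides.
\<close>

lemma bounded_frequency:
  fixes b :: "nat \<Rightarrow> real"
  assumes "\<And>\<eta>. \<eta> \<in> {0..1} \<Longrightarrow> (\<lambda>n. exp (\<i> * of_real (b n * (1 + \<eta>)))) \<longlonglongrightarrow> 1"
  shows "\<exists>n. \<bar>b n\<bar> < pi"
proof (rule ccontr)
  assume "\<not> ?thesis"
  then have b: "pi \<le> \<bar>b n\<bar>" for n
    by (meson not_less)
  have "(\<lambda>n. integral {0..1} (\<lambda>\<eta>. exp (\<i> * of_real (b n * (1 + \<eta>))))) \<longlonglongrightarrow> integral {0..1::real} (\<lambda>\<eta>. 1::complex)"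
  proof (rule dominated_convergence(2)[where h = "\<lambda>_. 1"])
    show "(\<lambda>\<eta>. exp (\<i> * of_real (b k * (1 + \<eta>)))) integrable_on {0..1}" for k
      by (intro integrable_continuous_interval continuous_intros)
  qed (use assms in auto)
  then have lim: "(\<lambda>n. cmod (integral {0..1} (\<lambda>\<eta>. exp (\<i> * of_real (b n * (1 + \<eta>)))))) \<longlonglongrightarrow> 1"
    using tendsto_norm by fastforce
  have bound: "cmod (integral {0..1} (\<lambda>\<eta>. exp (\<i> * of_real (b n * (1 + \<eta>))))) \<le> 2 / pi" for n
  proof -
    have "0 < \<bar>b n\<bar>" using b[of n] pi_gt_zero by linarith
    then have "b n \<noteq> 0" by simp
    then have "cmod (integral {0..1} (\<lambda>\<eta>. exp (\<i> * of_real (b n * (1 + \<eta>))))) \<le> 2 / \<bar>b n\<bar>"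
      by (rule norm_integral_exp_le)
    also have "\<dots> \<le> 2 / pi"
      using b[of n] \<open>0 < \<bar>b n\<bar>\<close> by (intro divide_left_mono mult_pos_pos) simp_all
    finally show ?thesis .
  qed
  have "1 \<le> 2 / pi"
    by (rule LIMSEQ_le_const2[OF lim]) (use bound in blast)
  then show False
    using pi_gt3 by (simp add: field_simps)
qed


section \<open>The perturbed semigroups near a real parameter\<close>

lemma dominant_unique:
  assumes "dominant t \<mu> p" and "spans w p" and "dominant t \<mu>' p'" and "spans w' p'"
  shows "\<mu> = \<mu>'" and "p = p'"
proof -
  note s = dominant_imp_simple_top_eigenvalue[OF assms(1,2)] dominant_imp_simple_top_eigenvalue[OF assms(3,4)]
  show "\<mu> = \<mu>'"
    using s(1,3) by (rule simple_top_eigenvalue_unique)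
  then show "p = p'"
    using s(2,4) by (simp add: op_of_inject)
qed

lemma tendsto_scaleC_cancel:
  fixes x :: "nat \<Rightarrow> 'b::complex_normed_vector"
  assumes "x \<longlonglongrightarrow> y" and "y \<noteq> 0" and "(\<lambda>n. c n *\<^sub>C x n) \<longlonglongrightarrow> d *\<^sub>C y"
  shows "c \<longlonglongrightarrow> d"
proof -
  have "(\<lambda>n. c n *\<^sub>C x n - d *\<^sub>C x n) \<longlonglongrightarrow> d *\<^sub>C y - d *\<^sub>C y"
    by (intro tendsto_diff assms(3) scaleC.tendsto tendsto_const assms(1))
  then have "(\<lambda>n. norm ((c n - d) *\<^sub>C x n) / norm (x n)) \<longlonglongrightarrow> norm (0::'b) / norm y"
    using assms(1,2) by (intro tendsto_intros) (simp_all add: scaleC.diff_left)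
  moreover have "\<forall>\<^sub>F n in sequentially. x n \<noteq> 0"
    using assms(1,2) by (rule tendsto_imp_eventually_ne)
  then have "\<forall>\<^sub>F n in sequentially. norm ((c n - d) *\<^sub>C x n) / norm (x n) = cmod (c n - d)"
    by eventually_elim (simp add: norm_scaleC)
  ultimately have "(\<lambda>n. cmod (c n - d)) \<longlonglongrightarrow> 0"
    by (auto intro: Lim_transform_eventually)
  then show ?thesis
    by (simp add: tendsto_norm_zero_iff LIM_zero_iff)
qed

lemma sgn_exp_complex: "sgn (exp z) = exp (\<i> * of_real (Im z))" for z :: complex
  by (subst exp_eq_polar) (simp add: sgn_mult sgn_of_real cis_conv_exp sgn_eq norm_mult)

text \<open>
  For small \<open>s\<close>, stability at time \<open>1\<close> and the semigroup law give dominance at all times with eigenvalue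
  \<open>exp (t * a)\<close>. The point is that \<open>a\<close> is the principal logarithm. Along a sequence \<open>s n\<close> tending to \<open>0\<close>,
  the projections converge, so for each \<open>\<eta>\<close> the eigenvalues \<open>exp ((1 + \<eta>) * a n)\<close> converge to the
  eigenvalue at \<open>0\<close>, which is positive. Their phases \<open>exp (\<i> * Im (a n) * (1 + \<eta>))\<close> therefore tend
  to \<open>1\<close> for every \<open>\<eta>\<close>, and the imaginary parts cannot all be \<open>pi\<close> or more in modulus.
\<close>

lemma principal_branch_near_real_parameter:
  fixes g :: "real \<Rightarrow> real \<Rightarrow> 'a::complex_banach clop"
  assumes zero: "\<And>s. g s 0 = 1" and add: "\<And>s t u. 0 \<le> t \<Longrightarrow> 0 \<le> u \<Longrightarrow> g s (t + u) = g s t * g s u"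
    and lim: "\<And>s. (g s \<longlongrightarrow> 1) (at_right 0)"
    and cont: "\<And>\<eta>. \<eta> \<in> {0..1} \<Longrightarrow> isCont (\<lambda>s. g s (1 + \<eta>)) 0"
    and top: "\<And>\<eta>. \<eta> \<in> {0..1} \<Longrightarrow> \<exists>\<mu>::real. 0 < \<mu> \<and> simple_top_eigenvalue (op_of (g 0 (1 + \<eta>))) (of_real \<mu>)"
  shows "\<exists>d>0. \<forall>s. \<bar>s\<bar> < d \<longrightarrow> (\<exists>a p w. spans w p \<and> \<bar>Im a\<bar> < pi \<and>
    (\<forall>t>0. dominant (g s t) (exp (of_real t * a)) p))"
proof -
  define Q where "Q s a p w \<longleftrightarrow> spans w p \<and> (\<forall>t>0. dominant (g s t) (exp (of_real t * a)) p)" for s a p w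
  have Q_intro: "\<exists>a. Q s a p w" if "dominant (g s 1) \<mu> p" "spans w p" for s \<mu> p w
    using semigroup_dominant[OF zero add lim that] that(2) by (auto simp: Q_def)
  have Q_unique: "p = p'" if "Q s a p w" "Q s a' p' w'" for s a p w a' p' w'
    using that dominant_unique(2)[of "g s 1"] unfolding Q_def by (meson zero_less_one)
  obtain \<mu>0 :: real where "simple_top_eigenvalue (op_of (g 0 1)) (of_real \<mu>0)"
    using top[of 0] by auto
  then obtain p0 w0 where p0: "dominant (g 0 1) (of_real \<mu>0) p0" "spans w0 p0"
    using simple_top_eigenvalue_imp_dominant by blast
  obtain a0 where a0: "Q 0 a0 p0 w0"
    using Q_intro[OF p0] by blast
  have near: "\<exists>d>0. \<forall>s. \<bar>s\<bar> < d \<longrightarrow> (\<exists>a p w. Q s a p w \<and> norm (p - p0) < e)" if "0 < e" for e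
  proof -
    obtain h where "h > 0" and h: "\<And>t'. norm (t' - g 0 1) < h \<Longrightarrow>
        \<exists>\<mu>' p' w'. dominant t' \<mu>' p' \<and> spans w' p' \<and> norm (p' - p0) < e"
      using dominant_stable[OF p0 \<open>0 < e\<close>] by blast
    have "isCont (\<lambda>s. g s 1) 0"
      using cont[of 0] by simp
    then obtain d where "d > 0" "\<And>s. \<bar>s\<bar> < d \<Longrightarrow> norm (g s 1 - g 0 1) < h"
      using \<open>h > 0\<close> unfolding continuous_at_eps_delta dist_norm by (metis diff_0_right real_norm_def)
    then show ?thesis
      using h Q_intro by (intro exI[of _ d]) blast
  qed
  have "\<exists>d>0. \<forall>s. \<bar>s\<bar> < d \<longrightarrow> (\<exists>a p w. Q s a p w \<and> \<bar>Im a\<bar> < pi)"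
  proof (rule ccontr)
    assume no: "\<not> ?thesis"
    obtain d1 where d1: "d1 > 0" "\<And>s. \<bar>s\<bar> < d1 \<Longrightarrow> \<exists>a p w. Q s a p w"
      using near[OF zero_less_one] by blast
    have "\<exists>s a p w. \<bar>s\<bar> < inverse (real (Suc n)) \<and> Q s a p w \<and> \<not> \<bar>Im a\<bar> < pi" for n
    proof -
      have "0 < min d1 (inverse (real (Suc n)))" using d1(1) by simp
      then obtain s where s: "\<bar>s\<bar> < min d1 (inverse (real (Suc n)))"
        and far: "\<nexists>a p w. Q s a p w \<and> \<bar>Im a\<bar> < pi"
        using no by blast
      obtain a p w where "Q s a p w"
        using d1(2)[of s] s by auto
      then show ?thesis
        using s far by (metis min_less_iff_conj)
    qed
    then obtain s a p w where s: "\<And>n. \<bar>s n\<bar> < inverse (real (Suc n))"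
      and Q: "\<And>n. Q (s n) (a n) (p n) (w n)" and Im: "\<And>n. \<not> \<bar>Im (a n)\<bar> < pi"
      by metis
    have s0: "s \<longlonglongrightarrow> 0"
      by (rule Lim_null_comparison[OF _ LIMSEQ_inverse_real_of_nat])
        (use s in \<open>auto intro!: always_eventually less_imp_le\<close>)
    have p_lim: "p \<longlonglongrightarrow> p0"
      unfolding tendsto_iff dist_norm
    proof (intro allI impI)
      fix e :: real assume "0 < e"
      then obtain d where "d > 0" and d: "\<And>s. \<bar>s\<bar> < d \<Longrightarrow> \<exists>a p w. Q s a p w \<and> norm (p - p0) < e"
        using near by blast
      have "\<forall>\<^sub>F n in sequentially. \<bar>s n\<bar> < d"
        using s0 \<open>d > 0\<close> by (simp add: tendsto_iff)
      then show "\<forall>\<^sub>F n in sequentially. norm (p n - p0) < e"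
        by eventually_elim (metis d Q Q_unique)
    qed
    have "p0 \<noteq> 0"
      using p0(2) by (rule spans_nonzero)
    have "(\<lambda>n. exp (\<i> * of_real (Im (a n) * (1 + \<eta>)))) \<longlonglongrightarrow> 1" if \<eta>: "\<eta> \<in> {0..1}" for \<eta>
    proof -
      let ?e = "\<lambda>a. exp (of_real (1 + \<eta>) * a)"
      have eig: "g s (1 + \<eta>) * p = ?e a *\<^sub>C p" if "Q s a p w" for s a p w
        using that \<eta> by (auto simp: Q_def dominant_def simp del: of_real_add)
      have "(\<lambda>n. g (s n) (1 + \<eta>)) \<longlonglongrightarrow> g 0 (1 + \<eta>)"
        using isCont_tendsto_compose[OF cont[OF \<eta>] s0] .
      then have "(\<lambda>n. g (s n) (1 + \<eta>) * p n) \<longlonglongrightarrow> g 0 (1 + \<eta>) * p0"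
        by (intro tendsto_mult p_lim)
      then have "(\<lambda>n. ?e (a n) *\<^sub>C p n) \<longlonglongrightarrow> ?e a0 *\<^sub>C p0"
        by (simp only: eig[OF Q] eig[OF a0])
      from tendsto_scaleC_cancel[OF p_lim \<open>p0 \<noteq> 0\<close> this]
      have "(\<lambda>n. sgn (?e (a n))) \<longlonglongrightarrow> sgn (?e a0)"
        by (intro tendsto_sgn) simp_all
      moreover have "sgn (?e a0) = 1"
      proof -
        obtain \<mu> :: real where \<mu>: "0 < \<mu>" "simple_top_eigenvalue (op_of (g 0 (1 + \<eta>))) (of_real \<mu>)"
          using top[OF \<eta>] by blast
        have "dominant (g 0 (1 + \<eta>)) (?e a0) p0"
          using a0 \<eta> by (simp add: Q_def del: of_real_add)
        then have "simple_top_eigenvalue (op_of (g 0 (1 + \<eta>))) (?e a0)"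
          using p0(2) by (rule dominant_imp_simple_top_eigenvalue)
        then have "?e a0 = of_real \<mu>"
          using \<mu>(2) by (rule simple_top_eigenvalue_unique)
        then show ?thesis
          using \<mu>(1) by (simp add: sgn_of_real del: of_real_add)
      qed
      moreover have "sgn (?e (a n)) = exp (\<i> * of_real (Im (a n) * (1 + \<eta>)))" for n
        by (simp only: sgn_exp_complex) (simp add: mult.commute)
      ultimately show ?thesis by simp
    qed
    from bounded_frequency[OF this] show False
      using Im by blast
  qed
  then obtain d where "d > 0" and d: "\<And>s. \<bar>s\<bar> < d \<Longrightarrow> \<exists>a p w. Q s a p w \<and> \<bar>Im a\<bar> < pi"
    by blast
  show ?thesis
  proof (intro exI[of _ d] conjI allI impI)
    fix s assume "\<bar>s\<bar> < d"
    from d[OF this] obtain a p w where "Q s a p w" "\<bar>Im a\<bar> < pi"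
      by blast
    then show "\<exists>a p w. spans w p \<and> \<bar>Im a\<bar> < pi \<and> (\<forall>t>0. dominant (g s t) (exp (of_real t * a)) p)"
      by (auto simp: Q_def)
  qed fact
qed

theorem proposition2p1:
  fixes L :: "complex \<Rightarrow> real \<Rightarrow> ('a::complex_banach \<Rightarrow>\<^sub>L 'a)"
    and \<delta> \<theta> :: real
  assumes "\<delta> > 0"
    and "operator_semigroups \<delta> L"
    and "condition_D1 \<delta> L"
    and "condition_D2 \<delta> L"
    and "\<theta> \<in> {-\<delta><..<\<delta>}"
  shows "\<exists>\<delta>'>0. \<exists>\<Lambda> :: complex \<Rightarrow> real \<Rightarrow> ('a \<Rightarrow>\<^sub>L 'a). \<forall>s\<in>{-\<delta>'<..<\<delta>'}.
           let z = Complex \<theta> s;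
               lam = top_eigenvalue (L z 1);
               P = top_eigenprojection (L z 1)
           in simple_top_eigenvalue (L z 1) lam \<and>
              (\<forall>t\<ge>1.
                 simple_top_eigenvalue (L z t) (lam powr of_real t) \<and>
                 eigenprojection (L z t) (lam powr of_real t) = P \<and>
                 L z t = (lam powr of_real t) *\<^sub>C P + \<Lambda> z t \<and>
                 P o\<^sub>L \<Lambda> z t = 0 \<and> \<Lambda> z t o\<^sub>L P = 0) \<and>
              (\<forall>t\<ge>1. \<forall>N\<ge>1. \<Lambda> z (t * real N) = blinfun_power (\<Lambda> z t) N) \<and>
              spectral_radius (\<Lambda> z 1) < cmod lam"
proof -
  define G where "G s t = Clop (L (Complex \<theta> s) t)" for s t
  define \<Lambda> where "\<Lambda> z t = L z t - (top_eigenvalue (L z 1) powr of_real t) *\<^sub>C top_eigenprojection (L z 1)"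
    for z :: complex and t :: real
  have strip: "\<bar>Re (Complex \<theta> s)\<bar> < \<delta>" for s
    using assms(5) by auto
  note semi = assms(2)[unfolded operator_semigroups_def, rule_format, OF strip]
  have op_G: "op_of (G s t) = L (Complex \<theta> s) t" if "0 \<le> t" for s t
    unfolding G_def using semi that by (intro Clop_inverse) blast
  have zero: "G s 0 = 1" for s
    using semi by (simp add: op_G op_of_simps flip: op_of_inject)
  have add: "G s (t + u) = G s t * G s u" if "0 \<le> t" "0 \<le> u" for s t u
    using semi that by (simp add: op_G op_of_simps flip: op_of_inject)
  have lim: "(G s \<longlongrightarrow> 1) (at_right 0)" for s
  proof -
    have "((\<lambda>t. norm (L (Complex \<theta> s) t - id_blinfun)) \<longlongrightarrow> 0) (at_right 0)"
      using semi[of s] by (simp add: tendsto_norm_zero_iff LIM_zero_iff)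
    moreover have "\<forall>\<^sub>F t in at_right 0. norm (L (Complex \<theta> s) t - id_blinfun) = norm (G s t - 1)"
      by (auto simp: eventually_at_filter norm_clop.rep_eq op_of_simps op_G)
    ultimately have "((\<lambda>t. norm (G s t - 1)) \<longlongrightarrow> 0) (at_right 0)"
      by (rule Lim_transform_eventually)
    then show ?thesis
      by (simp add: tendsto_norm_zero_iff LIM_zero_iff)
  qed
  have cont: "isCont (\<lambda>s. G s (1 + \<eta>)) 0" if "\<eta> \<in> {0..1}" for \<eta>
  proof -
    have "continuous_on {z. \<bar>Re z\<bar> < \<delta>} (\<lambda>z. L z (1 + \<eta>))"
      using assms(3) that by (simp add: condition_D1_def condition_B1_def)
    moreover have "continuous_on UNIV (Complex \<theta>)"
      unfolding Complex_eq by (intro continuous_intros)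
    ultimately have "continuous_on UNIV (\<lambda>s. L (Complex \<theta> s) (1 + \<eta>))"
      by (rule continuous_on_compose2) (use strip in auto)
    then have "((\<lambda>s. norm (L (Complex \<theta> s) (1 + \<eta>) - L (Complex \<theta> 0) (1 + \<eta>))) \<longlongrightarrow> 0) (at 0)"
      by (simp add: continuous_on_eq_continuous_at isCont_def tendsto_norm_zero_iff LIM_zero_iff)
    then have "((\<lambda>s. norm (G s (1 + \<eta>) - G 0 (1 + \<eta>))) \<longlongrightarrow> 0) (at 0)"
      using that by (simp add: norm_clop.rep_eq op_of_simps op_G)
    then show ?thesis
      by (simp add: isCont_def tendsto_norm_zero_iff LIM_zero_iff)
  qed
  have top: "\<exists>\<mu>::real. 0 < \<mu> \<and> simple_top_eigenvalue (op_of (G 0 (1 + \<eta>))) (of_real \<mu>)"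
    if "\<eta> \<in> {0..1}" for \<eta>
    using assms(3,5) that
    by (auto simp: condition_D1_def condition_B2_def op_G complex_of_real_def)
  obtain d where "d > 0" and d: "\<And>s. \<bar>s\<bar> < d \<Longrightarrow> \<exists>a p w. spans w p \<and> \<bar>Im a\<bar> < pi \<and>
      (\<forall>t>0. dominant (G s t) (exp (of_real t * a)) p)"
    using principal_branch_near_real_parameter[of G, OF zero add lim cont top] by blast
  show ?thesis
  proof (intro exI[of _ d] conjI exI[of _ \<Lambda>] ballI)
    fix s assume "s \<in> {-d<..<d}"
    then obtain a p w where spans: "spans w p" and Im: "\<bar>Im a\<bar> < pi"
      and dom: "\<And>t. 0 < t \<Longrightarrow> dominant (G s t) (exp (of_real t * a)) p"
      using d[of s] by (auto simp: abs_less_iff)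
    let ?L = "L (Complex \<theta> s)"
    have simple: "simple_top_eigenvalue (?L t) (exp (of_real t * a))"
      and proj: "eigenprojection (?L t) (exp (of_real t * a)) = op_of p" if "0 < t" for t
      using dominant_imp_simple_top_eigenvalue[OF dom[OF that] spans] that by (simp_all add: op_G)
    have lam: "top_eigenvalue (?L 1) = exp a"
      using top_eigenvalue_eqI[OF simple[of 1]] by simp
    have P: "top_eigenprojection (?L 1) = op_of p"
      using proj[of 1] by (simp add: top_eigenprojection_def lam)
    have "Ln (exp a) = a"
      using Im by (intro Ln_exp) (auto simp: abs_less_iff)
    then have powr: "exp a powr of_real t = exp (of_real t * a)" for t
      by (simp add: powr_def)
    have p: "p * p = p" "G s t * p = exp (of_real t * a) *\<^sub>C p" "p * G s t = exp (of_real t * a) *\<^sub>C p"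
      if "0 < t" for t
      using dom[OF that] by (auto simp: dominant_def)
    have \<Lambda>: "\<Lambda> (Complex \<theta> s) t = op_of (G s t * (1 - p))" if "0 < t" for t
      using that p(2)[OF that] by (simp add: \<Lambda>_def lam P powr right_diff_distrib op_G op_of_simps)
    have "p * (G s t * (1 - p)) = 0" "G s t * (1 - p) * p = 0" if "0 < t" for t
      using p[OF that] by (simp_all add: algebra_simps scaleC_mult_left scaleC_mult_right)
    then have ann: "op_of p o\<^sub>L \<Lambda> (Complex \<theta> s) t = 0" "\<Lambda> (Complex \<theta> s) t o\<^sub>L op_of p = 0" if "0 < t" for t
      using that by (simp_all add: \<Lambda> flip: op_of_simps)
    have power: "\<Lambda> (Complex \<theta> s) (t * real N) = blinfun_power (\<Lambda> (Complex \<theta> s) t) N" if "1 \<le> t" "1 \<le> N" for t N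
    proof -
      have "(G s t * (1 - p)) ^ N = G s t ^ N * (1 - p)"
        using that p[of t] by (intro power_times_idempotent) (simp_all add: algebra_simps)
      also have "G s t ^ N = G s (t * real N)"
        using semigroup_power[of "G s" t N, OF zero add] that by (simp add: mult.commute)
      finally show ?thesis
        using that by (simp add: \<Lambda> flip: op_of_power)
    qed
    have "spectral_radius (\<Lambda> (Complex \<theta> s) 1) < cmod (exp a)"
    proof -
      let ?N = "G s 1 * (1 - p)"
      obtain \<rho> where \<rho>: "\<rho> < cmod (exp a)" "spec ?N \<subseteq> cball 0 \<rho>"
        using dominant_spec[OF dom[of 1]] by auto
      have "0 \<in> spec ?N"
      proof (rule ccontr)
        assume "0 \<notin> spec ?N"
        then have "rsv ?N 0 * (0 *\<^sub>C 1 - ?N) = 1"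
          using is_inverse_rsv[of 0 ?N] unfolding is_inverse_def by blast
        then have "p = rsv ?N 0 * (0 *\<^sub>C 1 - ?N) * p" by simp
        also have "\<dots> = 0"
          using \<open>\<And>t. 0 < t \<Longrightarrow> G s t * (1 - p) * p = 0\<close>[of 1] by (simp add: mult.assoc)
        finally show False
          using spans_nonzero[OF spans] by simp
      qed
      then have "spectral_radius (\<Lambda> (Complex \<theta> s) 1) \<le> \<rho>"
        unfolding spectral_radius_def \<Lambda>[OF zero_less_one] spectrum_op_of
        using \<rho>(2) by (intro cSUP_least) auto
      then show ?thesis using \<rho>(1) by simp
    qed
    then show "let z = Complex \<theta> s;
               lam = top_eigenvalue (L z 1);
               P = top_eigenprojection (L z 1)
           in simple_top_eigenvalue (L z 1) lam \<and>
              (\<forall>t\<ge>1.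
                 simple_top_eigenvalue (L z t) (lam powr of_real t) \<and>
                 eigenprojection (L z t) (lam powr of_real t) = P \<and>
                 L z t = (lam powr of_real t) *\<^sub>C P + \<Lambda> z t \<and>
                 P o\<^sub>L \<Lambda> z t = 0 \<and> \<Lambda> z t o\<^sub>L P = 0) \<and>
              (\<forall>t\<ge>1. \<forall>N\<ge>1. \<Lambda> z (t * real N) = blinfun_power (\<Lambda> z t) N) \<and>
              spectral_radius (\<Lambda> z 1) < cmod lam"
      unfolding Let_def lam P powr
      using simple[of 1] simple proj ann power by (auto simp: \<Lambda>_def lam P powr)
  qed fact
qed

end
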